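(* Let $m, n, k \geq 1$ be integers with $k \le m$ (no relation between $m$ and $n$ is assumed), and let $\sigma_1, \ldots, \sigma_m \ge 0$ be real numbers with $\sigma_i = 1$ for all $i > k$. Let $\mathbf{G}$ be a random real $m \times n$ matrix whose entries are independent with $(\mathbf{G})_{i,j} \sim N(0, \sigma_i^2)$ for all $1 \le i \le m$, $1 \le j \le n$, and let $\mathbf{W} := \mathbf{G}\mathbf{G}^T$. Let $\mathbf{H}$ be a random real $m \times n$ matrix with independent entries satisfying, for all index pairs lying in the range $1 \le i \le m$, $1 \le j \le n$: 1. $(\mathbf{H})_{i,i}$ is distributed as $\sigma_i \chi_{n-i+1}$; 2. $(\mathbf{H})_{i,i-k}$ is distributed as $\sigma_i \chi_{m-i+1}$ for $i > k$; 3. $(\mathbf{H})_{i,j}$ is distributed as $N(0, \sigma_i^2)$ for $i-k < j < i$; 4. $(\mathbf{H})_{i,j} = 0$ for $j > i$ or $j < i-k$. Let $\mathbf{W}' := \mathbf{H}\mathbf{H}^T$. Then the eigenvalues of $\mathbf{W}$ and the eigenvalues of $\mathbf{W}'$ have the same distribution; that is, the random vector in $\mathbb{R}^m$ of eigenvalues of $\mathbf{W}$, listed in decreasing order with multiplicity, has the same law as the corresponding random vector for $\mathbf{W}'$.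
   Context: $N(0,\sigma^2)$ denotes the normal distribution with mean $0$ and variance $\sigma^2$ (the point mass at $0$ if $\sigma = 0$). For a positive integer $\alpha$, $\chi_\alpha$ denotes the distribution of the nonnegative square root of a $\chi^2$ random variable with $\alpha$ degrees of freedom, i.e. the distribution of the Euclidean norm of a vector of $\alpha$ independent $N(0,1)$ variables; "distributed as $\sigma\chi_\alpha$" means distributed as $\sigma$ times such a variable. $\mathbf{A}^T$ denotes the transpose of $\mathbf{A}$. Here $\sigma_i$ is the standard deviation of the $i$th variable (row), the first $k$ of them being the "spiked" ones. The case $n < m$ (where $\mathbf{W}$ is singular, the pseudo-Wishart case) is included. *)

theory Defs
  imports "HOL-Probability.Probability" "Jordan_Normal_Form.Char_Poly"
begin

definition normal_law :: "real \<Rightarrow> real measure" where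
  "normal_law s =
     (if s = 0 then return borel 0 else density lborel (\<lambda>x. ennreal (normal_density 0 s x)))"

text \<open>Law of the Euclidean norm of a vector of \<open>a\<close> independent standard normal variables.\<close>

definition chi_law :: "nat \<Rightarrow> real measure" where
  "chi_law a =
     distr (PiM {1..a} (\<lambda>_. normal_law 1)) borel (\<lambda>x. sqrt (\<Sum>i\<in>{1..a}. (x i)\<^sup>2))"

definition scaled_chi_law :: "real \<Rightarrow> nat \<Rightarrow> real measure" where
  "scaled_chi_law s a = distr (chi_law a) borel (\<lambda>x. s * x)"

text \<open>Rows and columns are numbered from 1 in the entry function, whereas the matrix type
  counts from 0.\<close>

definition entry :: "real mat \<Rightarrow> nat \<Rightarrow> nat \<Rightarrow> real" where
  "entry A i j = A $$ (i - 1, j - 1)"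

text \<open>The real eigenvalues in decreasing order, each repeated according to its algebraic
  multiplicity. For a symmetric \<open>m \<times> m\<close> matrix the list has length \<open>m\<close>.\<close>

definition eigenvalues_desc :: "real mat \<Rightarrow> real list" where
  "eigenvalues_desc A = rev (sorted_list_of_multiset (proots (char_poly A)))"

definition eigenvalue_vector :: "nat \<Rightarrow> real mat \<Rightarrow> nat \<Rightarrow> real" where
  "eigenvalue_vector m A = (\<lambda>i\<in>{1..m}. eigenvalues_desc A ! (i - 1))"

lemma set_eigenvalues_desc:
  assumes "A \<in> carrier_mat m m"
  shows "set (eigenvalues_desc A) = {x. eigenvalue A x}"
proof -
  have "char_poly A \<noteq> 0"
    using degree_monic_char_poly[OF assms] by auto
  then show ?thesis
    using eigenvalue_root_char_poly[OF assms]
    by (auto simp: eigenvalues_desc_def)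
qed

end

theory Submission
  imports Defs "Jordan_Normal_Form.Schur_Decomposition"
begin

unbundle no inner_syntax

text \<open>
  The eigenvalues of \<open>A A\<^sup>T\<close> are nonnegative, and the decreasing list of them is a measurable function
  of the power sums, that is of the traces \<open>tr ((A A\<^sup>T)\<^sup>r)\<close> with \<open>r \<ge> 1\<close>: once the larger ones are
  removed, the largest remaining one is the limit of the \<open>r\<close>-th roots of the \<open>r\<close>-th power sums. These
  traces are polynomials in the entries, they are unchanged when \<open>A\<close> is multiplied by orthogonal
  matrices on either side, and they agree for \<open>A\<close> and \<open>A\<^sup>T\<close>.

  Golub--Kahan band reduction alternates two steps. An orthogonal transformation of the columns
  \<open>j, \<dots>, n\<close> turns the part of row \<open>j\<close> in these columns into \<open>(\<parallel>\<cdot>\<parallel>, 0, \<dots>, 0)\<close>, and one of the rows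
  \<open>j + k, \<dots>, m\<close> does the same to column \<open>j\<close>. The transformation depends only on the entries
  that it concentrates. Conditionally on these, it preserves the law of the other entries, which are
  independent centred normal (or zero) with equal variances along each transformed line. So the entries
  stay independent, and the norms contribute the \<open>\<chi>\<close> laws.
\<close>

subsection \<open>Eigenvalues and power sums\<close>

definition mat_trace :: "'a :: comm_semiring_1 mat \<Rightarrow> 'a" where
  "mat_trace A = (\<Sum>i<dim_row A. A $$ (i, i))"

lemma mat_trace_comm:
  assumes "A \<in> carrier_mat m n" "B \<in> carrier_mat n m"
  shows "mat_trace (A * B) = mat_trace (B * A)"
proof -
  have "mat_trace (A * B) = (\<Sum>i<m. \<Sum>j<n. A $$ (i, j) * B $$ (j, i))"
    using assms by (auto simp: mat_trace_def scalar_prod_def atLeast0LessThan intro!: sum.cong)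
  also have "\<dots> = (\<Sum>j<n. \<Sum>i<m. A $$ (i, j) * B $$ (j, i))"
    by (rule sum.swap)
  also have "\<dots> = mat_trace (B * A)"
    using assms by (auto simp: mat_trace_def scalar_prod_def atLeast0LessThan mult.commute intro!: sum.cong)
  finally show ?thesis .
qed

lemma mult_pow_mat_shift:
  assumes "A \<in> carrier_mat m n" "B \<in> carrier_mat n m"
  shows "(A * B) ^\<^sub>m r * A = A * (B * A) ^\<^sub>m r"
proof (induction r)
  case 0
  then show ?case using assms by auto
next
  case (Suc r)
  have AB: "A * B \<in> carrier_mat m m" "B * A \<in> carrier_mat n n" using assms by auto
  note p = pow_carrier_mat[OF AB(1), of r] pow_carrier_mat[OF AB(2), of r]
  have "(A * B) ^\<^sub>m Suc r * A = (A * B) ^\<^sub>m r * (A * B * A)"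
    using assms p AB by (simp add: assoc_mult_mat[of _ m m _ m _ n])
  also have "\<dots> = (A * B) ^\<^sub>m r * A * (B * A)"
    using assms p AB by (simp add: assoc_mult_mat[of _ m m _ n _ n] assoc_mult_mat[of A m n B m A n])
  also have "\<dots> = A * (B * A) ^\<^sub>m Suc r"
    using assms p AB Suc by (simp add: assoc_mult_mat[of _ m n _ n _ n])
  finally show ?case .
qed

text \<open>Moving one factor \<open>A\<close> cyclically around the trace turns one product into
  the other. The exponent has to be positive: at exponent 0 the two traces are m and n.\<close>

lemma mat_trace_pow_comm:
  assumes A: "A \<in> carrier_mat m n" and B: "B \<in> carrier_mat n m"
  shows "mat_trace ((A * B) ^\<^sub>m Suc r) = mat_trace ((B * A) ^\<^sub>m Suc r)"
proof -
  have AB: "A * B \<in> carrier_mat m m" "B * A \<in> carrier_mat n n" using assms by auto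
  note p = pow_carrier_mat[OF AB(1), of r] pow_carrier_mat[OF AB(2), of r]
  have "(A * B) ^\<^sub>m Suc r = ((A * B) ^\<^sub>m r * A) * B"
    using assms p AB by (simp add: assoc_mult_mat[of _ m m A n B m])
  also have "mat_trace \<dots> = mat_trace (B * ((A * B) ^\<^sub>m r * A))"
    using assms p by (intro mat_trace_comm[where m=m and n=n]) auto
  also have "\<dots> = mat_trace (B * A * (B * A) ^\<^sub>m r)"
    using assms p unfolding mult_pow_mat_shift[OF A B]
    by (simp add: assoc_mult_mat[of B n m A n _ n])
  also have "\<dots> = mat_trace ((B * A) ^\<^sub>m Suc r)"
    using assms p AB by (simp add: mat_trace_comm[of _ n n])
  finally show ?thesis .
qed

lemma upper_triangular_mult:
  fixes A B :: "'a :: comm_semiring_1 mat"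
  assumes "A \<in> carrier_mat n n" "B \<in> carrier_mat n n" "upper_triangular A" "upper_triangular B"
  shows "upper_triangular (A * B)" and "i < n \<Longrightarrow> (A * B) $$ (i, i) = A $$ (i, i) * B $$ (i, i)"
proof -
  have *: "A $$ (i, l) * B $$ (l, j) = 0" if "i < n" "j < n" "l < n" "j \<le> i" "\<not> (l = i \<and> l = j)" for i j l
  proof (cases "l < i")
    case True
    then show ?thesis using assms that by (simp add: upper_triangularD[OF assms(3)])
  next
    case False
    with that have "j < l" by auto
    then show ?thesis using assms that by (simp add: upper_triangularD[OF assms(4)])
  qed
  have e: "(A * B) $$ (i, j) = (\<Sum>l<n. A $$ (i, l) * B $$ (l, j))" if "i < n" "j < n" for i j
    using assms that by (auto simp: scalar_prod_def atLeast0LessThan intro!: sum.cong)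
  show "upper_triangular (A * B)"
    using assms * by (intro upper_triangularI) (auto simp: e simp del: index_mult_mat(1) intro!: sum.neutral)
  show "i < n \<Longrightarrow> (A * B) $$ (i, i) = A $$ (i, i) * B $$ (i, i)"
    using * by (subst e) (auto simp: sum.remove[of "{..<n}" i] intro!: sum.neutral)
qed

lemma upper_triangular_pow:
  fixes A :: "'a :: comm_semiring_1 mat"
  assumes "A \<in> carrier_mat n n" "upper_triangular A"
  shows "upper_triangular (A ^\<^sub>m r) \<and> (\<forall>i<n. (A ^\<^sub>m r) $$ (i, i) = (A $$ (i, i)) ^ r)"
proof (induction r)
  case 0
  then show ?case using assms by (auto simp: upper_triangular_def)
next
  case (Suc r)
  then show ?case
    using upper_triangular_mult[OF pow_carrier_mat[OF assms(1)] assms(1) _ assms(2)]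
    by (auto simp: mult.commute)
qed

text \<open>By Schur decomposition \<open>A\<close> is similar to an upper triangular matrix with
  diagonal \<open>es\<close>. The trace of a power is invariant under similarity, and powers of a
  triangular matrix have the powers of its diagonal entries on the diagonal.\<close>

lemma mat_trace_pow_char_poly:
  fixes A :: "real mat"
  assumes A: "A \<in> carrier_mat n n" and c: "char_poly A = (\<Prod>e\<leftarrow>es. [:- e, 1:])"
  shows "mat_trace (A ^\<^sub>m r) = (\<Sum>e\<leftarrow>es. e ^ r)"
proof -
  obtain B P Q where s: "schur_decomposition A es = (B, P, Q)" by (metis prod_cases3)
  from schur_decomposition[OF A c s] have
    w: "similar_mat_wit A B P Q" and u: "upper_triangular B" and d: "diag_mat B = es" by auto
  from similar_mat_witD2[OF A w] have
    B: "B \<in> carrier_mat n n" and PQ: "P \<in> carrier_mat n n" "Q \<in> carrier_mat n n" and QP: "Q * P = 1\<^sub>m n" by auto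
  note Br = pow_carrier_mat[OF B, of r]
  from similar_mat_witD2[OF pow_carrier_mat[OF A] similar_mat_wit_pow[OF w]]
  have "A ^\<^sub>m r = P * B ^\<^sub>m r * Q" by blast
  then have "mat_trace (A ^\<^sub>m r) = mat_trace (P * (B ^\<^sub>m r * Q))"
    using PQ Br by (simp add: assoc_mult_mat[of P n n _ n _ n])
  also have "\<dots> = mat_trace (B ^\<^sub>m r * Q * P)"
    using PQ Br by (intro mat_trace_comm) auto
  also have "\<dots> = mat_trace (B ^\<^sub>m r)"
    using PQ Br QP by (simp add: assoc_mult_mat[of _ n n _ n _ n] right_mult_one_mat[OF Br])
  also have "\<dots> = (\<Sum>i<n. (B $$ (i, i)) ^ r)"
    using B Br upper_triangular_pow[OF B u, of r] by (simp add: mat_trace_def)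
  also have "\<dots> = (\<Sum>e\<leftarrow>es. e ^ r)"
    using B by (simp add: d[symmetric] diag_mat_def sum_list_sum_nth atLeast0LessThan o_def)
  finally show ?thesis .
qed

text \<open>An eigenvector v satisfies z |v|^2 = |A^T v|^2. In the order on complex numbers,
  \<open>z \<ge> 0\<close> also says that z is real, so this one inequality yields both the reality
  and the sign of the spectrum.\<close>

lemma eigenvalue_gram_nonneg:
  fixes A :: "real mat"
  assumes A: "A \<in> carrier_mat m n" and e: "eigenvalue (map_mat complex_of_real (A * A\<^sup>T)) z"
  shows "z \<ge> 0"
proof -
  let ?A = "map_mat complex_of_real A"
  have cA: "?A \<in> carrier_mat m n" "?A\<^sup>T \<in> carrier_mat n m" using A by auto
  have mm: "map_mat complex_of_real (A * A\<^sup>T) = ?A * ?A\<^sup>T"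
    using A by (simp add: of_real_hom.mat_hom_mult[of A m n _ m] map_mat_transpose)
  from e obtain v where v: "v \<in> carrier_vec m" "v \<noteq> 0\<^sub>v m" "(?A * ?A\<^sup>T) *\<^sub>v v = z \<cdot>\<^sub>v v"
    unfolding eigenvalue_def eigenvector_def mm using cA by auto
  define u where "u = ?A\<^sup>T *\<^sub>v v"
  have u: "u \<in> carrier_vec n" using cA v by (auto simp: u_def)
  \<comment> \<open>The entries of \<open>A\<close> are real, so conjugation passes through the
    matrix.\<close>
  have cu: "conjugate u = ?A\<^sup>T *\<^sub>v conjugate v"
    using cA v by (intro eq_vecI) (auto simp: u_def scalar_prod_def conjugate_vec_def)
  have "z * (v \<bullet>c v) = (?A * ?A\<^sup>T *\<^sub>v v) \<bullet>c v"
    using v by simp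
  also have "\<dots> = (?A *\<^sub>v u) \<bullet> conjugate v"
    using cA v by (simp add: u_def assoc_mult_mat_vec[of _ m n _ m])
  also have "\<dots> = conjugate v \<bullet> (?A *\<^sub>v u)"
    using cA v u by (intro comm_scalar_prod[of _ m]) auto
  also have "\<dots> = (?A\<^sup>T *\<^sub>v conjugate v) \<bullet> u"
    using cA v u by (intro transpose_vec_mult_scalar[symmetric, of _ m n]) auto
  also have "\<dots> = u \<bullet>c u"
    unfolding cu[symmetric] using u by (intro comm_scalar_prod[of _ n]) auto
  finally have *: "z * (v \<bullet>c v) = u \<bullet>c u" .
  have 1: "v \<bullet>c v > 0" using v by (simp add: conjugate_square_greater_0_vec[of v m])
  have 2: "u \<bullet>c u \<ge> 0" by (rule conjugate_square_ge_0_vec)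
  have "z = (u \<bullet>c u) / (v \<bullet>c v)" using * 1 by (auto simp: field_simps)
  also have "\<dots> \<ge> 0" using 1 2 by (auto simp: less_eq_complex_def less_complex_def complex_eq_iff Re_divide Im_divide)
  finally show ?thesis .
qed

text \<open>Over the complex numbers the characteristic polynomial splits, and its roots are real
  and nonnegative by the preceding lemma. The factorization then descends to the reals because the
  coefficient embedding is injective.\<close>

lemma char_poly_gram_factorized:
  fixes A :: "real mat"
  assumes A: "A \<in> carrier_mat m n"
  obtains es where "char_poly (A * A\<^sup>T) = (\<Prod>e\<leftarrow>es. [:- e, 1:])" "length es = m" "\<And>e. e \<in> set es \<Longrightarrow> e \<ge> 0"
proof -
  let ?W = "A * A\<^sup>T"
  let ?C = "map_mat complex_of_real ?W"
  have W: "?W \<in> carrier_mat m m" "?C \<in> carrier_mat m m" using A by auto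
  from char_poly_factorized[OF W(2)] obtain zs where
    zs: "char_poly ?C = (\<Prod>z\<leftarrow>zs. [:- z, 1:])" "length zs = m" by auto
  have pos: "z \<ge> 0" if "z \<in> set zs" for z
  proof (rule eigenvalue_gram_nonneg[OF A])
    show "eigenvalue ?C z"
      using that by (auto simp: eigenvalue_root_char_poly[OF W(2)] zs(1) poly_prod_list prod_list_zero_iff o_def)
  qed
  interpret h: map_poly_inj_idom_hom complex_of_real ..
  define es where "es = map Re zs"
  have zs': "zs = map complex_of_real es"
    using pos by (auto simp: es_def less_eq_complex_def complex_eq_iff intro!: nth_equalityI)
  have "map_poly complex_of_real (char_poly ?W) = (\<Prod>z\<leftarrow>zs. [:- z, 1:])"
    using of_real_hom.char_poly_hom[OF W(1)] zs by metis
  also have "\<dots> = map_poly complex_of_real (\<Prod>e\<leftarrow>es. [:- e, 1:])"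
    by (simp add: zs' h.hom_prod_list o_def)
  finally have "char_poly ?W = (\<Prod>e\<leftarrow>es. [:- e, 1:])" by simp
  moreover have "length es = m" by (simp add: es_def zs)
  moreover have "\<And>e. e \<in> set es \<Longrightarrow> e \<ge> 0" using pos by (auto simp: es_def less_eq_complex_def)
  ultimately show ?thesis using that by blast
qed

lemma eigenvalues_desc_gram:
  fixes A :: "real mat"
  assumes A: "A \<in> carrier_mat m n"
  shows "length (eigenvalues_desc (A * A\<^sup>T)) = m"
    and "\<And>e. e \<in> set (eigenvalues_desc (A * A\<^sup>T)) \<Longrightarrow> e \<ge> 0"
    and "mat_trace ((A * A\<^sup>T) ^\<^sub>m r) = (\<Sum>e\<leftarrow>eigenvalues_desc (A * A\<^sup>T). e ^ r)"
proof -
  obtain es where es: "char_poly (A * A\<^sup>T) = (\<Prod>e\<leftarrow>es. [:- e, 1:])" "length es = m" "\<And>e. e \<in> set es \<Longrightarrow> e \<ge> 0"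
    using char_poly_gram_factorized[OF A] by blast
  have "proots (char_poly (A * A\<^sup>T)) = (\<Sum>p\<leftarrow>map (\<lambda>e. [:- e, 1:]) es. proots p)"
    unfolding es by (subst proots_prod_list[symmetric]) auto
  also have "\<dots> = mset es" by (induction es) auto
  finally have p: "proots (char_poly (A * A\<^sup>T)) = mset es" .
  then have m: "mset (eigenvalues_desc (A * A\<^sup>T)) = mset es"
    by (simp add: eigenvalues_desc_def)
  show "length (eigenvalues_desc (A * A\<^sup>T)) = m"
    using mset_eq_length[OF m] es by simp
  show "\<And>e. e \<in> set (eigenvalues_desc (A * A\<^sup>T)) \<Longrightarrow> e \<ge> 0"
    using mset_eq_setD[OF m] es by simp
  have "(\<Sum>e\<leftarrow>eigenvalues_desc (A * A\<^sup>T). e ^ r) = (\<Sum>e\<leftarrow>es. e ^ r)"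
    using m by (metis mset_map sum_mset_sum_list)
  then show "mat_trace ((A * A\<^sup>T) ^\<^sub>m r) = (\<Sum>e\<leftarrow>eigenvalues_desc (A * A\<^sup>T). e ^ r)"
    using mat_trace_pow_char_poly[of "A * A\<^sup>T" m es r] A es by simp
qed

lemma eigenvalues_desc_antimono:
  assumes "i \<le> j" "j < length (eigenvalues_desc A)"
  shows "eigenvalues_desc A ! j \<le> eigenvalues_desc A ! i"
  using assms unfolding eigenvalues_desc_def
  by (auto simp: rev_nth intro!: sorted_nth_mono)

text \<open>Indices are shifted: \<open>p r\<close> stands for the power sum of exponent \<open>Suc r\<close>.\<close>

fun nth_of_power_sums :: "nat \<Rightarrow> (nat \<Rightarrow> real) \<Rightarrow> real" where
  "nth_of_power_sums i p =
     lim (\<lambda>r. root (Suc r) (p r - (\<Sum>j\<in>{..<i}. nth_of_power_sums j p ^ Suc r)))"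

declare nth_of_power_sums.simps [simp del]

text \<open>Once the i larger values are subtracted, the remaining sum of powers lies between the
  power of \<open>xs ! i\<close> and \<open>length xs\<close> times that power. Taking roots and
  letting the exponent grow squeezes the limit to \<open>xs ! i\<close>, since the roots of a
  positive constant tend to 1. Strong induction makes the subtraction exact.\<close>

lemma nth_of_power_sums:
  assumes anti: "\<And>i j. i \<le> j \<Longrightarrow> j < length xs \<Longrightarrow> xs ! j \<le> xs ! i"
    and nonneg: "\<And>x. x \<in> set xs \<Longrightarrow> x \<ge> 0"
    and p: "\<And>r. p r = (\<Sum>x\<leftarrow>xs. x ^ Suc r)"
    and "i < length xs"
  shows "nth_of_power_sums i p = xs ! i"
  using \<open>i < length xs\<close>
proof (induction i rule: less_induct)
  case (less i)
  define L where "L = real (length xs)"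
  have L: "L > 0" using less by (auto simp: L_def)
  have xi: "xs ! i \<ge> 0" using nonneg less by auto
  have eq: "p r - (\<Sum>j\<in>{..<i}. nth_of_power_sums j p ^ Suc r) = (\<Sum>j\<in>{i..<length xs}. (xs ! j) ^ Suc r)" for r
  proof -
    have "(\<Sum>j\<in>{..<i}. nth_of_power_sums j p ^ Suc r) = (\<Sum>j\<in>{..<i}. (xs ! j) ^ Suc r)"
      using less by (intro sum.cong) auto
    moreover have "p r = (\<Sum>j\<in>{..<length xs}. (xs ! j) ^ Suc r)"
      by (simp add: p sum_list_sum_nth atLeast0LessThan)
    moreover have "{..<length xs} = {..<i} \<union> {i..<length xs}" using less by auto
    moreover have "{..<i} \<inter> {i..<length xs} = {}" by auto
    ultimately show ?thesis by (simp add: sum.union_disjoint)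
  qed
  have lo: "xs ! i \<le> root (Suc r) (\<Sum>j\<in>{i..<length xs}. (xs ! j) ^ Suc r)" for r
  proof -
    have "(xs ! i) ^ Suc r \<le> (\<Sum>j\<in>{i..<length xs}. (xs ! j) ^ Suc r)"
      using less nonneg by (intro member_le_sum) (auto intro!: zero_le_power mult_nonneg_nonneg)
    then have "root (Suc r) ((xs ! i) ^ Suc r) \<le> root (Suc r) (\<Sum>j\<in>{i..<length xs}. (xs ! j) ^ Suc r)"
      by (rule real_root_le_mono[rotated]) simp
    then show ?thesis using xi by (simp only: real_root_power_cancel)
  qed
  have hi: "root (Suc r) (\<Sum>j\<in>{i..<length xs}. (xs ! j) ^ Suc r) \<le> root (Suc r) L * xs ! i" for r
  proof -
    have "(\<Sum>j\<in>{i..<length xs}. (xs ! j) ^ Suc r) \<le> (\<Sum>j\<in>{i..<length xs}. (xs ! i) ^ Suc r)"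
      using anti nonneg by (intro sum_mono power_mono) auto
    also have "\<dots> \<le> L * (xs ! i) ^ Suc r"
      using xi by (auto simp: L_def intro!: mult_right_mono mult_nonneg_nonneg)
    finally have "root (Suc r) (\<Sum>j\<in>{i..<length xs}. (xs ! j) ^ Suc r) \<le> root (Suc r) (L * (xs ! i) ^ Suc r)"
      by (rule real_root_le_mono[rotated]) simp
    then show ?thesis using xi by (simp only: real_root_power_cancel real_root_mult)
  qed
  have "(\<lambda>r. root (Suc r) L * xs ! i) \<longlonglongrightarrow> 1 * xs ! i"
    using LIMSEQ_Suc[OF LIMSEQ_root_const[OF L]] by (rule tendsto_mult) (rule tendsto_const)
  then have "(\<lambda>r. root (Suc r) L * xs ! i) \<longlonglongrightarrow> xs ! i"
    by simp
  then have "(\<lambda>r. root (Suc r) (\<Sum>j\<in>{i..<length xs}. (xs ! j) ^ Suc r)) \<longlonglongrightarrow> xs ! i"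
    by (rule tendsto_sandwich[OF _ _ tendsto_const[of "xs ! i"], rotated 2]) (use lo hi in \<open>auto simp del: power_Suc\<close>)
  then show ?case
    by (subst nth_of_power_sums.simps) (simp only: eq limI)
qed

text \<open>The recursion involves only finite sums, powers, roots and pointwise limits, so
  eigenvalues become measurable without any continuity argument for roots of polynomials.\<close>

lemma measurable_nth_of_power_sums [measurable]:
  "nth_of_power_sums i \<in> borel_measurable (PiM UNIV (\<lambda>_. borel))"
proof (induction i rule: less_induct)
  case (less i)
  then have [measurable]: "\<And>j. j \<in> {..<i} \<Longrightarrow> nth_of_power_sums j \<in> borel_measurable (PiM UNIV (\<lambda>_. borel))"
    by auto
  show ?case
    by (subst nth_of_power_sums.simps[abs_def]) measurable
qed

subsection \<open>Rotation invariance of products of normal laws\<close>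

text \<open>The condition ranges over all indices, not just those of a given product, because
  \<open>product_prob_space\<close> asks for a probability measure at every index.\<close>

definition prob_laws :: "('i \<Rightarrow> real measure) \<Rightarrow> bool" where
  "prob_laws D \<longleftrightarrow> (\<forall>p. prob_space (D p) \<and> sets (D p) = sets borel)"

lemma prob_lawsD:
  assumes "prob_laws D"
  shows "prob_space (D p)" "sets (D p) = sets borel" "space (D p) = UNIV"
    "sets (PiM J D) = sets (PiM J (\<lambda>_. borel))" "space (PiM J D) = extensional J"
    "prob_space (PiM J D)" "product_prob_space D"
proof -
  show *: "prob_space (D p)" "sets (D p) = sets borel" for p
    using assms by (auto simp: prob_laws_def)
  show s: "space (D p) = UNIV" for p
    using sets_eq_imp_space_eq[OF *(2)[of p]] by simp
  show "sets (PiM J D) = sets (PiM J (\<lambda>_. borel))"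
    by (intro sets_PiM_cong) (simp_all add: *)
  show "space (PiM J D) = extensional J" by (simp add: space_PiM s PiE_UNIV_domain PiE_def)
  show "prob_space (PiM J D)" by (intro prob_space_PiM *)
  show "product_prob_space D" by (rule product_prob_spaceI) (rule *)
qed

lemma sets_normal_law [simp, measurable_cong]: "sets (normal_law s) = sets borel"
  by (simp add: normal_law_def)

lemma space_normal_law [simp]: "space (normal_law s) = UNIV"
  by (simp add: normal_law_def)

lemma prob_space_normal_law: "s \<ge> 0 \<Longrightarrow> prob_space (normal_law s)"
  by (auto simp: normal_law_def prob_space_return prob_space_normal_density)

text \<open>The rotation splits into two one-dimensional affine substitutions joined by Fubini:
  first u = c x + s y for fixed y, then y = s u + c v for fixed u. Each contributes a factor |c|,
  and the two cancel. For c = 0 the rotation is a swap of the axes up to sign.\<close>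

lemma nn_integral_lborel_rotation:
  fixes h :: "real \<times> real \<Rightarrow> ennreal"
  assumes [measurable]: "h \<in> borel_measurable (borel \<Otimes>\<^sub>M borel)" and cs: "c\<^sup>2 + s\<^sup>2 = 1"
  shows "(\<integral>\<^sup>+y. \<integral>\<^sup>+x. h (c * x + s * y, c * y - s * x) \<partial>lborel \<partial>lborel) = (\<integral>\<^sup>+y. \<integral>\<^sup>+x. h (x, y) \<partial>lborel \<partial>lborel)"
proof (cases "c = 0")
  case True
  with cs have s: "s \<noteq> 0" "\<bar>s\<bar> = 1" by (auto simp: power2_eq_1_iff)
  have "(\<integral>\<^sup>+y. \<integral>\<^sup>+x. h (c * x + s * y, c * y - s * x) \<partial>lborel \<partial>lborel) = (\<integral>\<^sup>+y. \<integral>\<^sup>+x. h (s * y, - s * x) \<partial>lborel \<partial>lborel)"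
    using True by simp
  also have "\<dots> = (\<integral>\<^sup>+y. \<integral>\<^sup>+x. h (s * y, x) \<partial>lborel \<partial>lborel)"
    using nn_integral_real_affine[of "\<lambda>x. h (s * y, x)" "- s" 0 for y] s by simp
  also have "\<dots> = (\<integral>\<^sup>+y. \<integral>\<^sup>+x. h (y, x) \<partial>lborel \<partial>lborel)"
    using s by (subst nn_integral_real_affine[of "\<lambda>y. \<integral>\<^sup>+x. h (y, x) \<partial>lborel" s 0]) auto
  also have "\<dots> = (\<integral>\<^sup>+y. \<integral>\<^sup>+x. h (x, y) \<partial>lborel \<partial>lborel)"
    by (rule lborel_pair.Fubini') simp
  finally show ?thesis .
next
  case False
  have 1: "\<bar>c\<bar> * (\<integral>\<^sup>+x. h (c * x + s * y, c * y - s * x) \<partial>lborel) = (\<integral>\<^sup>+u. h (u, (y - s * u) / c) \<partial>lborel)" for y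
  proof -
    have *: "(y - s * (c * x + s * y)) / c = c * y - s * x" for x
    proof -
      have "y - s * (c * x + s * y) = (c\<^sup>2 + s\<^sup>2) * y - s * (c * x + s * y)" using cs by simp
      also have "\<dots> = c * (c * y - s * x)" by (simp add: algebra_simps power2_eq_square)
      finally show ?thesis using False by simp
    qed
    show ?thesis
      using False by (subst nn_integral_real_affine[of "\<lambda>u. h (u, (y - s * u) / c)" c "s * y"]) (auto simp: * add.commute)
  qed
  have 2: "(\<integral>\<^sup>+y. h (u, (y - s * u) / c) \<partial>lborel) = \<bar>c\<bar> * (\<integral>\<^sup>+v. h (u, v) \<partial>lborel)" for u
    using False by (subst nn_integral_real_affine[of _ c "s * u"]) auto
  have "\<bar>c\<bar> * (\<integral>\<^sup>+y. \<integral>\<^sup>+x. h (c * x + s * y, c * y - s * x) \<partial>lborel \<partial>lborel)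
      = (\<integral>\<^sup>+y. \<integral>\<^sup>+u. h (u, (y - s * u) / c) \<partial>lborel \<partial>lborel)"
    by (simp add: 1[symmetric] nn_integral_cmult)
  also have "\<dots> = (\<integral>\<^sup>+u. \<integral>\<^sup>+y. h (u, (y - s * u) / c) \<partial>lborel \<partial>lborel)"
    by (rule lborel_pair.Fubini'[symmetric]) simp
  also have "\<dots> = \<bar>c\<bar> * (\<integral>\<^sup>+u. \<integral>\<^sup>+v. h (u, v) \<partial>lborel \<partial>lborel)"
    by (simp add: 2 nn_integral_cmult)
  also have "(\<integral>\<^sup>+u. \<integral>\<^sup>+v. h (u, v) \<partial>lborel \<partial>lborel) = (\<integral>\<^sup>+y. \<integral>\<^sup>+x. h (x, y) \<partial>lborel \<partial>lborel)"
    by (rule lborel_pair.Fubini') simp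
  finally show ?thesis
    using False by (simp add: ennreal_mult_cancel_left)
qed

lemma nn_integral_normal_law:
  fixes h :: "real \<Rightarrow> ennreal"
  assumes "s \<noteq> 0" and [measurable]: "h \<in> borel_measurable borel"
  shows "(\<integral>\<^sup>+x. h x \<partial>normal_law s) = (\<integral>\<^sup>+x. normal_density 0 s x * h x \<partial>lborel)"
  using assms(1) by (simp add: normal_law_def nn_integral_density)

text \<open>The joint density of two independent centred normal variables of equal variance depends
  only on x^2 + y^2. Variance 0 is included: the point mass at the origin is fixed by
  rotations.\<close>

lemma nn_integral_normal_law_rotation:
  fixes h :: "real \<times> real \<Rightarrow> ennreal"
  assumes [measurable]: "h \<in> borel_measurable (borel \<Otimes>\<^sub>M borel)" and cs: "c\<^sup>2 + s\<^sup>2 = 1" and "\<sigma> \<ge> 0"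
  shows "(\<integral>\<^sup>+y. \<integral>\<^sup>+x. h (c * x + s * y, c * y - s * x) \<partial>normal_law \<sigma> \<partial>normal_law \<sigma>)
       = (\<integral>\<^sup>+y. \<integral>\<^sup>+x. h (x, y) \<partial>normal_law \<sigma> \<partial>normal_law \<sigma>)"
proof (cases "\<sigma> = 0")
  case True
  then show ?thesis by (simp add: normal_law_def nn_integral_return)
next
  case False
  define n where "n = normal_density 0 \<sigma>"
  interpret prob_space "normal_law \<sigma>" using assms by (intro prob_space_normal_law)
  have [measurable]: "n \<in> borel_measurable borel" by (simp add: n_def)
  have n0: "n x \<ge> 0" for x by (simp add: n_def)
  \<comment> \<open>The density is absorbed into the integrand, which turns the claim into the
    rotation invariance of Lebesgue measure.\<close>
  define g where "g = (\<lambda>(x, y). ennreal (n x * n y) * h (x, y))"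
  have [measurable]: "g \<in> borel_measurable (borel \<Otimes>\<^sub>M borel)" unfolding g_def by measurable
  have rot: "n (c * x + s * y) * n (c * y - s * x) = n x * n y" for x y
  proof -
    have "(c * x + s * y)\<^sup>2 + (c * y - s * x)\<^sup>2 = (c\<^sup>2 + s\<^sup>2) * (x\<^sup>2 + y\<^sup>2)"
      by (simp add: algebra_simps power2_eq_square)
    then have *: "(c * x + s * y)\<^sup>2 + (c * y - s * x)\<^sup>2 = x\<^sup>2 + y\<^sup>2" using cs by simp
    define C where "C = 1 / sqrt (2 * pi * \<sigma>\<^sup>2)"
    have e: "exp (- u\<^sup>2 / (2 * \<sigma>\<^sup>2)) * exp (- v\<^sup>2 / (2 * \<sigma>\<^sup>2)) = exp (- (u\<^sup>2 + v\<^sup>2) / (2 * \<sigma>\<^sup>2))" for u v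
      by (simp only: exp_add[symmetric] add_divide_distrib[symmetric] minus_add_distrib)
    have "n u = C * exp (- u\<^sup>2 / (2 * \<sigma>\<^sup>2))" for u
      by (simp add: n_def normal_density_def C_def)
    then have "n u * n v = C\<^sup>2 * exp (- (u\<^sup>2 + v\<^sup>2) / (2 * \<sigma>\<^sup>2))" for u v
      unfolding e[symmetric] by (simp only: power2_eq_square mult_ac)
    then show ?thesis by (simp only: *)
  qed
  have I: "(\<integral>\<^sup>+y. \<integral>\<^sup>+x. k (x, y) \<partial>normal_law \<sigma> \<partial>normal_law \<sigma>) = (\<integral>\<^sup>+y. \<integral>\<^sup>+x. ennreal (n x * n y) * k (x, y) \<partial>lborel \<partial>lborel)"
    if [measurable]: "k \<in> borel_measurable (borel \<Otimes>\<^sub>M borel)" for k :: "real \<times> real \<Rightarrow> ennreal"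
  proof -
    have "(\<integral>\<^sup>+y. \<integral>\<^sup>+x. k (x, y) \<partial>normal_law \<sigma> \<partial>normal_law \<sigma>)
       = (\<integral>\<^sup>+y. n y * (\<integral>\<^sup>+x. n x * k (x, y) \<partial>lborel) \<partial>lborel)"
      using False by (simp add: nn_integral_normal_law n_def)
    also have "\<dots> = (\<integral>\<^sup>+y. \<integral>\<^sup>+x. ennreal (n x * n y) * k (x, y) \<partial>lborel \<partial>lborel)"
      by (simp add: nn_integral_cmult[symmetric] ennreal_mult' n0 mult_ac)
    finally show ?thesis .
  qed
  have "(\<integral>\<^sup>+y. \<integral>\<^sup>+x. h (c * x + s * y, c * y - s * x) \<partial>normal_law \<sigma> \<partial>normal_law \<sigma>)
      = (\<integral>\<^sup>+y. \<integral>\<^sup>+x. g (c * x + s * y, c * y - s * x) \<partial>lborel \<partial>lborel)"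
    using I[of "\<lambda>(x, y). h (c * x + s * y, c * y - s * x)"] by (simp add: g_def rot)
  also have "\<dots> = (\<integral>\<^sup>+y. \<integral>\<^sup>+x. g (x, y) \<partial>lborel \<partial>lborel)"
    by (rule nn_integral_lborel_rotation[OF _ cs]) simp
  also have "\<dots> = (\<integral>\<^sup>+y. \<integral>\<^sup>+x. h (x, y) \<partial>normal_law \<sigma> \<partial>normal_law \<sigma>)"
    using I[of h] by (simp add: g_def)
  finally show ?thesis .
qed

lemma normal_law_scale:
  assumes "s \<ge> 0"
  shows "distr (normal_law 1) borel (\<lambda>x. s * x) = normal_law s"
proof (cases "s = 0")
  case True
  interpret prob_space "normal_law 1" by (intro prob_space_normal_law) auto
  show ?thesis using True by (simp add: normal_law_def[of 0] distr_const)
next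
  case False
  interpret prob_space "normal_law 1" by (intro prob_space_normal_law) auto
  have "distributed (normal_law 1) lborel (\<lambda>x. x) (normal_density 0 1)"
    by (auto simp: distributed_def normal_law_def distr_id2)
  from normal_density_affine[OF this, of s 0] False assms
  have "distributed (normal_law 1) lborel (\<lambda>x. s * x) (normal_density 0 s)" by simp
  then show ?thesis using False
    by (auto simp: distributed_def normal_law_def[of s] cong: distr_cong)
qed

lemma nn_integral_normal_law_minus:
  fixes h :: "real \<Rightarrow> ennreal"
  assumes [measurable]: "h \<in> borel_measurable borel"
  shows "(\<integral>\<^sup>+x. h (- x) \<partial>normal_law \<sigma>) = (\<integral>\<^sup>+x. h x \<partial>normal_law \<sigma>)"
proof (cases "\<sigma> = 0")
  case False
  have n: "normal_density 0 \<sigma> (- x) = normal_density 0 \<sigma> x" for x by (simp add: normal_density_def)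
  show ?thesis using False
    by (simp add: nn_integral_normal_law,
        subst nn_integral_real_affine[of "\<lambda>x. ennreal (normal_density 0 \<sigma> x) * h x" "-1" 0]) (simp_all add: n)
qed (simp add: normal_law_def nn_integral_return)

section \<open>Measure-preserving coordinate changes on product spaces\<close>

definition measure_preserving_map :: "'a measure \<Rightarrow> ('a \<Rightarrow> 'a) \<Rightarrow> bool" where
  "measure_preserving_map M F \<longleftrightarrow> F \<in> M \<rightarrow>\<^sub>M M \<and> distr M M F = M"

lemma measure_preserving_map_id: "measure_preserving_map M (\<lambda>x. x)"
  by (simp add: measure_preserving_map_def distr_id2)

lemma measure_preserving_map_comp:
  assumes "measure_preserving_map M F" "measure_preserving_map M G"
  shows "measure_preserving_map M (F \<circ> G)"
  using assms distr_distr[of F M M G M] by (auto simp: measure_preserving_map_def)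

lemma measure_preserving_mapI:
  assumes "F \<in> M \<rightarrow>\<^sub>M M"
    and "\<And>h. h \<in> borel_measurable M \<Longrightarrow> (\<integral>\<^sup>+x. h (F x) \<partial>M) = (\<integral>\<^sup>+x. h x \<partial>M)"
  shows "measure_preserving_map M F"
  unfolding measure_preserving_map_def
proof (intro conjI assms measure_eqI)
  fix A assume "A \<in> sets (distr M M F)"
  then show "emeasure (distr M M F) A = emeasure M A"
    using assms(2)[of "indicator A"] assms(1)
    by (simp add: nn_integral_distr[symmetric] nn_integral_indicator)
qed simp

lemma measurable_PiM_update:
  assumes "prob_laws D" "p \<in> J" and [measurable]: "f \<in> borel_measurable N" and g: "g \<in> N \<rightarrow>\<^sub>M PiM J D"
  shows "(\<lambda>w. (g w)(p := f w)) \<in> N \<rightarrow>\<^sub>M PiM J D"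
proof -
  have f: "f \<in> N \<rightarrow>\<^sub>M D p" by (subst measurable_cong_sets[OF refl prob_lawsD(2)[OF assms(1)]]) simp
  have "(\<lambda>w. (g w)(p := f w)) \<in> N \<rightarrow>\<^sub>M PiM (insert p J) D"
    by (rule measurable_fun_upd[OF _ g f]) auto
  then show ?thesis using assms(2) by (simp add: insert_absorb)
qed

lemma measurable_PiM_coord:
  assumes "prob_laws D" "p \<in> J"
  shows "(\<lambda>w. w p) \<in> borel_measurable (PiM J D)"
  using measurable_component_singleton[OF assms(2), of D]
  by (simp add: measurable_cong_sets[OF refl prob_lawsD(2)[OF assms(1)]])

text \<open>Fubini puts the coordinates \<open>p\<close> and \<open>q\<close> innermost; with all
  others frozen, the two-dimensional rotation invariance applies.\<close>

lemma measure_preserving_rotate_pair: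
  assumes D: "prob_laws D" and J: "finite J" "p \<in> J" "q \<in> J" "p \<noteq> q"
    and n: "D p = normal_law \<sigma>" "D q = normal_law \<sigma>" "\<sigma> \<ge> 0" and cs: "c\<^sup>2 + s\<^sup>2 = 1"
  shows "measure_preserving_map (PiM J D) (\<lambda>w. w(p := c * w p + s * w q, q := c * w q - s * w p))"
    (is "measure_preserving_map _ ?F")
proof (rule measure_preserving_mapI)
  interpret product_prob_space D by (rule prob_lawsD[OF D])
  note [measurable] = measurable_PiM_coord[OF D J(2)] measurable_PiM_coord[OF D J(3)]
  show F: "?F \<in> PiM J D \<rightarrow>\<^sub>M PiM J D"
    by (intro measurable_PiM_update[OF D] J measurable_ident_sets[OF refl]) measurable
  fix h :: "_ \<Rightarrow> ennreal" assume h: "h \<in> borel_measurable (PiM J D)"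
  define K where "K = J - {p, q}"
  have K: "J = insert p (insert q K)" "finite K" "q \<notin> K" "p \<notin> insert q K"
    using J by (auto simp: K_def)
  have I: "(\<integral>\<^sup>+w. k w \<partial>PiM J D) = (\<integral>\<^sup>+w. \<integral>\<^sup>+y. \<integral>\<^sup>+x. k (w(q := y, p := x)) \<partial>normal_law \<sigma> \<partial>normal_law \<sigma> \<partial>PiM K D)"
    if k: "k \<in> borel_measurable (PiM J D)" for k :: "_ \<Rightarrow> ennreal"
  proof -
    have k': "k \<in> borel_measurable (PiM (insert p (insert q K)) D)" using k K by simp
    have 1: "(\<lambda>w. \<integral>\<^sup>+x. k (w(p := x)) \<partial>D p) \<in> borel_measurable (PiM (insert q K) D)"
      using k' by measurable
    have "(\<integral>\<^sup>+w. k w \<partial>PiM J D) = (\<integral>\<^sup>+w. \<integral>\<^sup>+x. k (w(p := x)) \<partial>D p \<partial>PiM (insert q K) D)"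
      unfolding K(1) using K k' by (intro product_nn_integral_insert) auto
    also have "\<dots> = (\<integral>\<^sup>+w. \<integral>\<^sup>+y. \<integral>\<^sup>+x. k (w(q := y, p := x)) \<partial>D p \<partial>D q \<partial>PiM K D)"
      using K 1 by (intro product_nn_integral_insert) auto
    finally show ?thesis by (simp add: n)
  qed
  have hm: "(\<lambda>z. h (w(q := snd z, p := fst z))) \<in> borel_measurable (borel \<Otimes>\<^sub>M borel)" if "w \<in> space (PiM K D)" for w
  proof (rule measurable_compose[OF _ h])
    have "(\<lambda>z. w(q := snd z)) \<in> (borel \<Otimes>\<^sub>M borel) \<rightarrow>\<^sub>M PiM (insert q K) D"
      using that n by (intro measurable_fun_upd[where J=K]) (auto simp: measurable_cong_sets[OF refl prob_lawsD(2)[OF D]])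
    then show "(\<lambda>z. w(q := snd z, p := fst z)) \<in> borel \<Otimes>\<^sub>M borel \<rightarrow>\<^sub>M PiM J D"
      unfolding K(1)
      by (rule measurable_fun_upd[rotated]) (auto simp: measurable_cong_sets[OF refl prob_lawsD(2)[OF D]])
  qed
  have "(\<integral>\<^sup>+w. h (?F w) \<partial>PiM J D) = (\<integral>\<^sup>+w. \<integral>\<^sup>+y. \<integral>\<^sup>+x. h (?F (w(q := y, p := x))) \<partial>normal_law \<sigma> \<partial>normal_law \<sigma> \<partial>PiM K D)"
    by (intro I measurable_compose[OF F h])
  also have "\<dots> = (\<integral>\<^sup>+w. \<integral>\<^sup>+y. \<integral>\<^sup>+x. h (w(q := y, p := x)) \<partial>normal_law \<sigma> \<partial>normal_law \<sigma> \<partial>PiM K D)"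
  proof (rule nn_integral_cong)
    fix w assume w: "w \<in> space (PiM K D)"
    have "?F (w(q := y, p := x)) = w(q := c * y - s * x, p := c * x + s * y)" for x y
      using J(4) by auto
    then show "(\<integral>\<^sup>+y. \<integral>\<^sup>+x. h (?F (w(q := y, p := x))) \<partial>normal_law \<sigma> \<partial>normal_law \<sigma>)
      = (\<integral>\<^sup>+y. \<integral>\<^sup>+x. h (w(q := y, p := x)) \<partial>normal_law \<sigma> \<partial>normal_law \<sigma>)"
      using nn_integral_normal_law_rotation[OF hm[OF w] cs n(3)] by simp
  qed
  also have "\<dots> = (\<integral>\<^sup>+w. h w \<partial>PiM J D)" by (rule I[OF h, symmetric])
  finally show "(\<integral>\<^sup>+w. h (?F w) \<partial>PiM J D) = (\<integral>\<^sup>+w. h w \<partial>PiM J D)" .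
qed

lemma measure_preserving_flip:
  assumes D: "prob_laws D" and J: "finite J" "p \<in> J" and n: "D p = normal_law \<sigma>"
  shows "measure_preserving_map (PiM J D) (\<lambda>w. w(p := - w p))" (is "measure_preserving_map _ ?F")
proof (rule measure_preserving_mapI)
  interpret product_prob_space D by (rule prob_lawsD[OF D])
  note [measurable] = measurable_PiM_coord[OF D J(2)]
  show F: "?F \<in> PiM J D \<rightarrow>\<^sub>M PiM J D"
    by (intro measurable_PiM_update[OF D] J measurable_ident_sets[OF refl]) measurable
  fix h :: "_ \<Rightarrow> ennreal" assume h: "h \<in> borel_measurable (PiM J D)"
  define K where "K = J - {p}"
  have K: "J = insert p K" "finite K" "p \<notin> K" using J by (auto simp: K_def)
  have I: "(\<integral>\<^sup>+w. k w \<partial>PiM J D) = (\<integral>\<^sup>+w. \<integral>\<^sup>+x. k (w(p := x)) \<partial>normal_law \<sigma> \<partial>PiM K D)"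
    if k: "k \<in> borel_measurable (PiM J D)" for k :: "_ \<Rightarrow> ennreal"
    unfolding K(1) using K k by (subst product_nn_integral_insert) (auto simp: n)
  have hm: "(\<lambda>z. h (w(p := z))) \<in> borel_measurable borel" if "w \<in> space (PiM K D)" for w
    using that unfolding K(1)
    by (intro measurable_compose[OF _ h[unfolded K(1)]] measurable_fun_upd[where J=K])
       (auto simp: measurable_cong_sets[OF refl prob_lawsD(2)[OF D]])
  have "(\<integral>\<^sup>+w. h (?F w) \<partial>PiM J D) = (\<integral>\<^sup>+w. \<integral>\<^sup>+x. h (?F (w(p := x))) \<partial>normal_law \<sigma> \<partial>PiM K D)"
    by (intro I measurable_compose[OF F h])
  also have "\<dots> = (\<integral>\<^sup>+w. \<integral>\<^sup>+x. h (w(p := x)) \<partial>normal_law \<sigma> \<partial>PiM K D)"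
  proof (rule nn_integral_cong)
    fix w assume "w \<in> space (PiM K D)"
    from nn_integral_normal_law_minus[OF hm[OF this]]
    show "(\<integral>\<^sup>+x. h (?F (w(p := x))) \<partial>normal_law \<sigma>) = (\<integral>\<^sup>+x. h (w(p := x)) \<partial>normal_law \<sigma>)"
      by simp
  qed
  also have "\<dots> = (\<integral>\<^sup>+w. h w \<partial>PiM J D)" by (rule I[OF h, symmetric])
  finally show "(\<integral>\<^sup>+w. h (?F w) \<partial>PiM J D) = (\<integral>\<^sup>+w. h w \<partial>PiM J D)" .
qed

text \<open>The map \<open>T\<close> may depend on the pivot coordinates \<open>y\<close> in an arbitrary, even non-measurable, way,
  because it is removed before integrating over \<open>y\<close>.\<close>

lemma distr_PiM_pivot:
  assumes D: "prob_laws D" "prob_laws D'" and fin: "finite I" "K \<subseteq> I" and same: "\<And>p. p \<in> I - K \<Longrightarrow> D p = D' p"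
    and g: "g \<in> PiM K D \<rightarrow>\<^sub>M PiM K D'" "distr (PiM K D) (PiM K D') g = PiM K D'"
    and f: "f \<in> PiM I (\<lambda>_. borel) \<rightarrow>\<^sub>M S"
    and inv: "\<And>y. \<exists>T. measure_preserving_map (PiM (I - K) D) T \<and>
      (\<forall>x. x \<in> extensional (I - K) \<longrightarrow> f (merge K (I - K) (y, x)) = f (merge K (I - K) (g y, T x)))"
  shows "distr (PiM I D) S f = distr (PiM I D') S f"
proof (rule measure_eqI)
  interpret D: product_prob_space D by (rule prob_lawsD[OF D(1)])
  interpret D': product_prob_space D' by (rule prob_lawsD[OF D(2)])
  have finK: "finite K" "finite (I - K)" using fin finite_subset by auto
  have IK: "K \<union> (I - K) = I" "K \<inter> (I - K) = {}" using fin by auto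
  have fD: "f \<in> PiM I D \<rightarrow>\<^sub>M S" "f \<in> PiM I D' \<rightarrow>\<^sub>M S"
    using f by (simp_all add: measurable_cong_sets[OF prob_lawsD(4)[OF D(1)]] measurable_cong_sets[OF prob_lawsD(4)[OF D(2)]])
  have J: "PiM (I - K) D = PiM (I - K) D'" by (intro PiM_cong same refl)
  fix A assume "A \<in> sets (distr (PiM I D) S f)"
  then have A: "A \<in> sets S" by simp
  define h :: "_ \<Rightarrow> ennreal" where "h w = indicator A (f w)" for w
  have h: "h \<in> borel_measurable (PiM I D)" "h \<in> borel_measurable (PiM I D')"
    using A fD unfolding h_def by measurable
  have h': "(\<lambda>x. h (merge K (I - K) (y, x))) \<in> borel_measurable (PiM (I - K) D')" if "y \<in> space (PiM K D')" for y
    using that h(2) IK measurable_merge[of K "I - K" D']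
    by (intro measurable_compose[OF _ h(2)] measurable_compose[OF measurable_Pair1' measurable_merge[of K "I - K" D', unfolded IK]])
  have hh: "(\<lambda>y. \<integral>\<^sup>+x. h (merge K (I - K) (y, x)) \<partial>PiM (I - K) D') \<in> borel_measurable (PiM K D')"
  proof -
    interpret P: prob_space "PiM (I - K) D'" by (rule prob_lawsD[OF D(2)])
    have "(\<lambda>z. h (merge K (I - K) z)) \<in> borel_measurable (PiM K D' \<Otimes>\<^sub>M PiM (I - K) D')"
      by (intro measurable_compose[OF _ h(2)] measurable_merge[of K "I - K" D', unfolded IK])
    then show ?thesis by (intro P.borel_measurable_nn_integral) (simp add: case_prod_beta)
  qed
  have gs: "g y \<in> space (PiM K D')" if "y \<in> space (PiM K D)" for y
    using g(1) that by (rule measurable_space)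
  have "emeasure (distr (PiM I D) S f) A = (\<integral>\<^sup>+w. h w \<partial>PiM I D)"
    unfolding h_def using A fD by (subst nn_integral_distr[symmetric, of f _ S]) auto
  also have "\<dots> = (\<integral>\<^sup>+y. \<integral>\<^sup>+x. h (merge K (I - K) (y, x)) \<partial>PiM (I - K) D \<partial>PiM K D)"
    using D.product_nn_integral_fold[OF IK(2) finK, of h] h(1) IK(1) by simp
  \<comment> \<open>For frozen \<open>y\<close> the invariance property replaces \<open>y\<close> by
    \<open>g y\<close> at the cost of applying \<open>T\<close> to the other coordinates, and the
    inner integral absorbs \<open>T\<close>. The outer integral then depends on \<open>y\<close>
    through \<open>g y\<close> only, whose law is known.\<close>
  also have "\<dots> = (\<integral>\<^sup>+y. \<integral>\<^sup>+x. h (merge K (I - K) (g y, x)) \<partial>PiM (I - K) D' \<partial>PiM K D)"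
  proof (rule nn_integral_cong)
    fix y assume y: "y \<in> space (PiM K D)"
    obtain T where T: "T \<in> PiM (I - K) D \<rightarrow>\<^sub>M PiM (I - K) D" "distr (PiM (I - K) D) (PiM (I - K) D) T = PiM (I - K) D"
      "\<And>x. x \<in> extensional (I - K) \<Longrightarrow> f (merge K (I - K) (y, x)) = f (merge K (I - K) (g y, T x))"
      using inv unfolding measure_preserving_map_def by metis
    have "(\<integral>\<^sup>+x. h (merge K (I - K) (y, x)) \<partial>PiM (I - K) D) = (\<integral>\<^sup>+x. h (merge K (I - K) (g y, T x)) \<partial>PiM (I - K) D)"
      using T(3) by (intro nn_integral_cong) (simp add: h_def prob_lawsD(5)[OF D(1)])
    also have "\<dots> = (\<integral>\<^sup>+x. h (merge K (I - K) (g y, x)) \<partial>distr (PiM (I - K) D) (PiM (I - K) D) T)"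
      using h'[OF gs[OF y]] T(1) by (subst nn_integral_distr) (auto simp: J)
    finally show "(\<integral>\<^sup>+x. h (merge K (I - K) (y, x)) \<partial>PiM (I - K) D) = (\<integral>\<^sup>+x. h (merge K (I - K) (g y, x)) \<partial>PiM (I - K) D')"
      unfolding T(2) unfolding J .
  qed
  also have "\<dots> = (\<integral>\<^sup>+y. \<integral>\<^sup>+x. h (merge K (I - K) (y, x)) \<partial>PiM (I - K) D' \<partial>distr (PiM K D) (PiM K D') g)"
    using g(1) hh by (subst nn_integral_distr) auto
  also have "\<dots> = (\<integral>\<^sup>+w. h w \<partial>PiM I D')"
    unfolding g(2) using D'.product_nn_integral_fold[OF IK(2) finK, of h] h(2) IK(1) by simp
  also have "\<dots> = emeasure (distr (PiM I D') S f) A"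
    unfolding h_def using A fD by (subst nn_integral_distr[symmetric, of f _ S]) auto
  finally show "emeasure (distr (PiM I D) S f) A = emeasure (distr (PiM I D') S f) A" .
qed simp

subsection \<open>Orthogonal transformations concentrating a line\<close>

lemma PiM_eq_borel: "prob_laws D \<Longrightarrow> measurable (PiM J D) = measurable (PiM J (\<lambda>_. borel))"
  by (intro ext measurable_cong_sets prob_lawsD refl)

definition givens :: "nat \<Rightarrow> nat \<Rightarrow> real \<Rightarrow> real \<Rightarrow> (nat \<Rightarrow> real) \<Rightarrow> nat \<Rightarrow> real" where
  "givens a b c s z = z(a := c * z a + s * z b, b := c * z b - s * z a)"

definition flip :: "nat \<Rightarrow> (nat \<Rightarrow> real) \<Rightarrow> nat \<Rightarrow> real" where
  "flip a z = z(a := - z a)"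

text \<open>Orthogonal maps are represented by words in rotations and sign changes, so that
  invariance of inner products and of normal laws follows by induction from the case of a single
  move.\<close>

inductive_set line_moves :: "nat set \<Rightarrow> ((nat \<Rightarrow> real) \<Rightarrow> nat \<Rightarrow> real) set" for C where
  id: "(\<lambda>z. z) \<in> line_moves C"
| givens: "T \<in> line_moves C \<Longrightarrow> a \<in> C \<Longrightarrow> b \<in> C \<Longrightarrow> a \<noteq> b \<Longrightarrow> c\<^sup>2 + s\<^sup>2 = 1 \<Longrightarrow>
    (\<lambda>z. givens a b c s (T z)) \<in> line_moves C"
| flip: "T \<in> line_moves C \<Longrightarrow> a \<in> C \<Longrightarrow> (\<lambda>z. flip a (T z)) \<in> line_moves C"

lemma line_moves_mono: "T \<in> line_moves C \<Longrightarrow> C \<subseteq> C' \<Longrightarrow> T \<in> line_moves C'"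
  by (induction rule: line_moves.induct) (auto intro: line_moves.intros)

lemma line_moves_outside: "T \<in> line_moves C \<Longrightarrow> l \<notin> C \<Longrightarrow> T z l = z l"
  by (induction rule: line_moves.induct) (auto simp: givens_def flip_def)

lemma line_moves_local:
  "T \<in> line_moves C \<Longrightarrow> (\<And>l. l \<in> C \<Longrightarrow> z l = z' l) \<Longrightarrow> l \<in> C \<Longrightarrow> T z l = T z' l"
  by (induction arbitrary: l rule: line_moves.induct) (auto simp: givens_def flip_def)

text \<open>A rotation preserves the inner product within its coordinate plane and a flip changes
  both factors of one term. Hence one and the same move applied to every row of a matrix leaves the
  Gram matrix of the rows unchanged.\<close>

lemma line_moves_inner:
  assumes "T \<in> line_moves C" "C \<subseteq> F" "finite F"
  shows "(\<Sum>l\<in>F. T z l * T z' l) = (\<Sum>l\<in>F. z l * z' l)"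
  using assms(1)
proof (induction rule: line_moves.induct)
  case (givens T a b c s)
  define u v where "u = T z" and "v = T z'"
  have F: "F = insert a (insert b (F - {a, b}))" "finite (F - {a, b})" using givens assms by auto
  have S: "(\<Sum>l\<in>F. f l) = f a + f b + (\<Sum>l\<in>F - {a, b}. f l)" for f :: "nat \<Rightarrow> real"
    using givens F(2) by (subst F(1)) (simp add: add.assoc)
  have "(c * u a + s * u b) * (c * v a + s * v b) + (c * u b - s * u a) * (c * v b - s * v a)
      = (c\<^sup>2 + s\<^sup>2) * (u a * v a + u b * v b)"
    by (simp add: algebra_simps power2_eq_square)
  then have "(\<Sum>l\<in>F. givens a b c s u l * givens a b c s v l) = (\<Sum>l\<in>F. u l * v l)"
    using givens unfolding S by (simp add: givens_def)
  then show ?case using givens by (simp add: u_def v_def)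
next
  case (flip T a)
  have "flip a (T z) l * flip a (T z') l = T z l * T z' l" for l by (simp add: flip_def)
  then show ?case using flip by simp
qed simp

text \<open>Each rotation in the plane of \<open>a\<close> and \<open>b\<close> transfers the mass
  of coordinate \<open>b\<close> to \<open>a\<close>, one \<open>b\<close> at a time. The flip
  serves the base case, where a single coordinate has to become its absolute value. The move depends
  on \<open>z\<close>.\<close>

lemma line_moves_reduce:
  assumes "finite C" "a \<notin> C"
  shows "\<exists>T\<in>line_moves (insert a C). T z a = sqrt (\<Sum>l\<in>insert a C. (z l)\<^sup>2) \<and> (\<forall>l\<in>C. T z l = 0)"
  using assms
proof (induction C rule: finite_induct)
  case empty
  show ?case
  proof (cases "z a \<ge> 0")
    case True
    then show ?thesis by (intro bexI[OF _ line_moves.id]) auto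
  next
    case False
    then show ?thesis by (intro bexI[OF _ line_moves.flip[OF line_moves.id]]) (auto simp: flip_def)
  qed
next
  case (insert b C)
  then obtain T where T: "T \<in> line_moves (insert a C)" "T z a = sqrt (\<Sum>l\<in>insert a C. (z l)\<^sup>2)" "\<forall>l\<in>C. T z l = 0"
    by auto
  have ab: "a \<noteq> b" "a \<notin> C" "b \<notin> C" using insert by auto
  have T': "T \<in> line_moves (insert a (insert b C))" using T(1) by (rule line_moves_mono) auto
  have Tb: "T z b = z b" using ab by (intro line_moves_outside[OF T(1)]) auto
  define r where "r = sqrt ((T z a)\<^sup>2 + (z b)\<^sup>2)"
  have sq: "(T z a)\<^sup>2 = (\<Sum>l\<in>insert a C. (z l)\<^sup>2)" unfolding T(2) by (simp add: sum_nonneg)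
  have r: "r = sqrt (\<Sum>l\<in>insert a (insert b C). (z l)\<^sup>2)"
    using ab insert(1) by (simp add: r_def sq add_ac)
  have r2: "r\<^sup>2 = (T z a)\<^sup>2 + (z b)\<^sup>2" by (simp add: r_def)
  show ?case
  proof (cases "r = 0")
    case True
    then have "T z a = 0" "z b = 0" using r2 by (simp_all add: sum_power2_eq_zero_iff)
    then show ?thesis using True r T(3) Tb by (intro bexI[OF _ T']) simp
  next
    case False
    \<comment> \<open>The cosine and sine of the angle that turns the vector with coordinates
      \<open>T z a\<close> and \<open>z b\<close> onto the positive half-axis of
      \<open>a\<close>.\<close>
    define c s where "c = T z a / r" and "s = z b / r"
    have cs: "c\<^sup>2 + s\<^sup>2 = 1"
      using False r2 by (simp add: c_def s_def power_divide add_divide_distrib[symmetric] r2[symmetric])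
    have "c * T z a + s * T z b = (T z a * T z a + z b * z b) / r"
      by (simp add: c_def s_def Tb add_divide_distrib)
    also have "T z a * T z a + z b * z b = r * r" using r2 by (simp add: power2_eq_square)
    finally have "c * T z a + s * T z b = r * r / r" .
    also have "\<dots> = r" using False by simp
    finally have "c * T z a + s * T z b = r" .
    moreover have "c * T z b - s * T z a = 0" by (simp add: c_def s_def Tb)
    moreover have "(\<lambda>z. givens a b c s (T z)) \<in> line_moves (insert a (insert b C))"
      using T' ab cs by (intro line_moves.givens) auto
    ultimately show ?thesis using r T(3) ab
      by (intro bexI[of _ "\<lambda>z. givens a b c s (T z)"]) (auto simp: givens_def)
  qed
qed

definition on_rows :: "nat set \<Rightarrow> ((nat \<Rightarrow> real) \<Rightarrow> nat \<Rightarrow> real) \<Rightarrow> (nat \<times> nat \<Rightarrow> real) \<Rightarrow> nat \<times> nat \<Rightarrow> real" where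
  "on_rows R T w = (\<lambda>(i, l). if i \<in> R then T (\<lambda>l. w (i, l)) l else w (i, l))"

lemma measure_preserving_on_rows_rowwise:
  assumes "finite R" and "\<And>i. i \<in> R \<Longrightarrow> measure_preserving_map M (on_rows {i} T)"
  shows "measure_preserving_map M (on_rows R T)"
  using assms
proof (induction R rule: finite_induct)
  case empty
  have "on_rows {} T = (\<lambda>w. w)" by (auto simp: on_rows_def fun_eq_iff)
  then show ?case by (simp add: measure_preserving_map_id)
next
  case (insert i R)
  have "on_rows (insert i R) T = on_rows {i} T \<circ> on_rows R T"
    using insert(2) by (auto simp: on_rows_def fun_eq_iff)
  then show ?case using insert by (metis insertCI measure_preserving_map_comp)
qed

text \<open>The standard deviation \<open>s i\<close> may vary between rows but is constant along
  \<open>C\<close> within each row. Acting on a single row, every generator is a rotation of two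
  equal normal laws or a sign change of one, and the rows are treated successively.\<close>

lemma measure_preserving_on_rows:
  assumes D: "prob_laws D" and fin: "finite J" "finite R" and RC: "R \<times> C \<subseteq> J"
    and n: "\<And>i l. i \<in> R \<Longrightarrow> l \<in> C \<Longrightarrow> D (i, l) = normal_law (s i)" "\<And>i. i \<in> R \<Longrightarrow> s i \<ge> 0"
    and T: "T \<in> line_moves C"
  shows "measure_preserving_map (PiM J D) (on_rows R T)"
  using T
proof (induction rule: line_moves.induct)
  case id
  have "on_rows R (\<lambda>z. z) = (\<lambda>w. w)" by (auto simp: on_rows_def fun_eq_iff)
  then show ?case by (simp add: measure_preserving_map_id)
next
  case (givens T a b c t)
  have "measure_preserving_map (PiM J D) (on_rows {i} (givens a b c t))" if i: "i \<in> R" for i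
  proof -
    have "on_rows {i} (givens a b c t) =
        (\<lambda>w. w((i, a) := c * w (i, a) + t * w (i, b), (i, b) := c * w (i, b) - t * w (i, a)))"
      using givens by (auto simp: on_rows_def givens_def fun_eq_iff)
    moreover have "(i, a) \<in> J" "(i, b) \<in> J" "(i, a) \<noteq> (i, b)" using i RC givens by auto
    ultimately show ?thesis
      using measure_preserving_rotate_pair[where \<sigma> = "s i", OF D fin(1) _ _ _ n(1) n(1) n(2)] i givens by simp
  qed
  then have "measure_preserving_map (PiM J D) (on_rows R (givens a b c t))"
    by (rule measure_preserving_on_rows_rowwise[OF fin(2)])
  moreover have "on_rows R (\<lambda>z. givens a b c t (T z)) = on_rows R (givens a b c t) \<circ> on_rows R T"
    by (auto simp: on_rows_def fun_eq_iff)
  ultimately show ?case using givens by (metis measure_preserving_map_comp)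
next
  case (flip T a)
  have "measure_preserving_map (PiM J D) (on_rows {i} (flip a))" if i: "i \<in> R" for i
  proof -
    have "on_rows {i} (flip a) = (\<lambda>w. w((i, a) := - w (i, a)))"
      by (auto simp: on_rows_def flip_def fun_eq_iff)
    moreover have "(i, a) \<in> J" using i RC flip by auto
    ultimately show ?thesis
      using measure_preserving_flip[where \<sigma> = "s i", OF D fin(1) _ n(1)] i flip by simp
  qed
  then have "measure_preserving_map (PiM J D) (on_rows R (flip a))"
    by (rule measure_preserving_on_rows_rowwise[OF fin(2)])
  moreover have "on_rows R (\<lambda>z. flip a (T z)) = on_rows R (flip a) \<circ> on_rows R T"
    by (auto simp: on_rows_def fun_eq_iff)
  ultimately show ?case using flip by (metis measure_preserving_map_comp)
qed

section \<open>Chi laws as laws of norms of normal vectors\<close>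

lemma prob_space_chi_law: "prob_space (chi_law a)"
proof -
  interpret prob_space "PiM {1..a} (\<lambda>_. normal_law 1)"
    by (intro prob_space_PiM prob_space_normal_law) simp
  show ?thesis unfolding chi_law_def by (intro prob_space_distr) measurable
qed

lemma sets_chi_law [simp, measurable_cong]: "sets (chi_law a) = sets borel"
  by (simp add: chi_law_def)

lemma prob_space_scaled_chi_law: "prob_space (scaled_chi_law s a)"
proof -
  interpret prob_space "chi_law a" by (rule prob_space_chi_law)
  show ?thesis unfolding scaled_chi_law_def by (intro prob_space_distr) measurable
qed

lemma sets_scaled_chi_law [simp]: "sets (scaled_chi_law s a) = sets borel"
  by (simp add: scaled_chi_law_def)

text \<open>Two changes of variables lead back to the definition of \<open>chi_law\<close>: a
  bijection of \<open>K\<close> with an initial segment of the positive integers, and scaling of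
  standard normal coordinates by \<open>s\<close>.\<close>

lemma distr_norm_normal_laws:
  assumes "finite K" "s \<ge> 0" and D: "\<And>p. p \<in> K \<Longrightarrow> D p = normal_law s"
  shows "distr (PiM K D) borel (\<lambda>y. sqrt (\<Sum>p\<in>K. (y p)\<^sup>2)) = scaled_chi_law s (card K)"
proof -
  let ?A = "{1..card K}"
  let ?N = "\<lambda>_ :: nat. normal_law s"
  obtain e where e: "bij_betw e ?A K" using ex_bij_betw_nat_finite_1[OF assms(1)] by auto
  have "distr (PiM K (\<lambda>_. normal_law s)) (PiM ?A ?N) (\<lambda>y. \<lambda>i\<in>?A. y (e i)) = PiM ?A ?N"
    using e assms(2) by (intro distr_PiM_reindex prob_space_normal_law) (auto simp: bij_betw_def)
  note 1 = this[symmetric]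
  have "distr (PiM ?A (\<lambda>_. normal_law 1)) (PiM ?A ?N) (compose ?A (\<lambda>x. s * x)) = PiM ?A (\<lambda>_. distr (normal_law 1) (normal_law s) (\<lambda>x. s * x))"
    using assms(2) by (intro distr_PiM_finite_prob_space') (auto intro: prob_space_normal_law)
  also have "distr (normal_law 1) (normal_law s) (\<lambda>x. s * x) = normal_law s"
    using normal_law_scale[OF assms(2)] by (simp cong: distr_cong)
  finally have 2: "PiM ?A ?N = distr (PiM ?A (\<lambda>_. normal_law 1)) (PiM ?A ?N) (compose ?A (\<lambda>x. s * x))" ..
  have c: "compose ?A (\<lambda>x. s * x) \<in> PiM ?A (\<lambda>_. normal_law 1) \<rightarrow>\<^sub>M PiM ?A ?N"
    unfolding compose_def by measurable
  have sq: "sqrt (\<Sum>i\<in>?A. (s * x i)\<^sup>2) = s * sqrt (\<Sum>i\<in>?A. (x i)\<^sup>2)" for x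
    using assms(2) by (simp add: power_mult_distrib sum_distrib_left[symmetric] real_sqrt_mult)
  have "scaled_chi_law s (card K) = distr (PiM ?A (\<lambda>_. normal_law 1)) borel (\<lambda>x. s * sqrt (\<Sum>i\<in>?A. (x i)\<^sup>2))"
    unfolding scaled_chi_law_def chi_law_def by (subst distr_distr) (auto simp: o_def)
  also have "\<dots> = distr (PiM ?A (\<lambda>_. normal_law 1)) borel ((\<lambda>x. sqrt (\<Sum>i\<in>?A. (x i)\<^sup>2)) \<circ> compose ?A (\<lambda>x. s * x))"
    by (simp add: o_def compose_def sq del: One_nat_def)
  also have "\<dots> = distr (PiM ?A ?N) borel (\<lambda>x. sqrt (\<Sum>i\<in>?A. (x i)\<^sup>2))"
    by (subst 2, rule distr_distr[symmetric, OF _ c]) measurable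
  also have "\<dots> = distr (PiM K (\<lambda>_. normal_law s)) borel ((\<lambda>x. sqrt (\<Sum>i\<in>?A. (x i)\<^sup>2)) \<circ> (\<lambda>y. \<lambda>i\<in>?A. y (e i)))"
  proof (subst 1, rule distr_distr)
    show "(\<lambda>y. \<lambda>i\<in>?A. y (e i)) \<in> PiM K (\<lambda>_. normal_law s) \<rightarrow>\<^sub>M PiM ?A ?N"
      using e by (intro measurable_restrict measurable_component_singleton) (auto simp: bij_betw_def)
  qed measurable
  also have "(\<lambda>x. sqrt (\<Sum>i\<in>?A. (x i)\<^sup>2)) \<circ> (\<lambda>y. \<lambda>i\<in>?A. y (e i)) = (\<lambda>y. sqrt (\<Sum>p\<in>K. (y p)\<^sup>2))"
  proof
    fix y
    show "((\<lambda>x. sqrt (\<Sum>i\<in>?A. (x i)\<^sup>2)) \<circ> (\<lambda>y. \<lambda>i\<in>?A. y (e i))) y = sqrt (\<Sum>p\<in>K. (y p)\<^sup>2)"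
      using sum.reindex_bij_betw[OF e, of "\<lambda>p. (y p)\<^sup>2"] by (simp add: o_def)
  qed
  also have "PiM K (\<lambda>_. normal_law s) = PiM K D" by (intro PiM_cong) (simp_all add: D)
  finally show ?thesis ..
qed

text \<open>The image coordinates are again independent, since all but one of them are
  deterministic. Equality with the product measure is checked on boxes.\<close>

lemma distr_concentrate_norm:
  assumes D: "prob_laws D" "prob_laws D'" and K: "finite K" "pv \<in> K" and "s \<ge> 0"
    and n: "\<And>p. p \<in> K \<Longrightarrow> D p = normal_law s"
    and D': "D' pv = scaled_chi_law s (card K)" "\<And>p. p \<in> K - {pv} \<Longrightarrow> D' p = return borel 0"
  defines "g \<equiv> (\<lambda>y. \<lambda>p\<in>K. if p = pv then sqrt (\<Sum>q\<in>K. (y q)\<^sup>2) else 0)"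
  shows "g \<in> PiM K D \<rightarrow>\<^sub>M PiM K D'" and "distr (PiM K D) (PiM K D') g = PiM K D'"
proof -
  interpret D': product_prob_space D' by (rule prob_lawsD[OF D(2)])
  define N where "N y = sqrt (\<Sum>q\<in>K. (y q)\<^sup>2)" for y :: "_ \<Rightarrow> real"
  have N [measurable]: "N \<in> borel_measurable (PiM K D)"
    unfolding N_def PiM_eq_borel[OF D(1)] by measurable
  show g: "g \<in> PiM K D \<rightarrow>\<^sub>M PiM K D'"
    unfolding g_def N_def[symmetric]
    by (intro measurable_restrict) (auto simp: measurable_cong_sets[OF refl prob_lawsD(2)[OF D(2)]])
  show "distr (PiM K D) (PiM K D') g = PiM K D'"
  proof (rule D'.PiM_eqI[OF K(1)])
    fix A assume A: "\<And>p. p \<in> K \<Longrightarrow> A p \<in> sets (D' p)"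
    then have A': "A p \<in> sets borel" if "p \<in> K" for p using that prob_lawsD(2)[OF D(2)] by blast
    have "emeasure (distr (PiM K D) (PiM K D') g) (Pi\<^sub>E K A) = emeasure (PiM K D) (g -` (Pi\<^sub>E K A) \<inter> space (PiM K D))"
      using g A K by (intro emeasure_distr sets_PiM_I_finite) auto
    \<comment> \<open>Apart from the pivot every coordinate of \<open>g y\<close> is 0, so the
      preimage of a box is either empty or determined by the pivot side alone.\<close>
    also have "g -` (Pi\<^sub>E K A) \<inter> space (PiM K D) = (if \<forall>p\<in>K - {pv}. 0 \<in> A p then N -` A pv \<inter> space (PiM K D) else {})"
      using K(2) by (auto simp: g_def N_def PiE_iff split: if_splits)
    also have "emeasure (PiM K D) \<dots> = (if \<forall>p\<in>K - {pv}. 0 \<in> A p then emeasure (D' pv) (A pv) else 0)"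
      using A'[OF K(2)] distr_norm_normal_laws[OF K(1) \<open>s \<ge> 0\<close> n, folded N_def]
      by (simp add: D'(1) emeasure_distr[OF N, symmetric])
    also have "\<dots> = emeasure (D' pv) (A pv) * (\<Prod>p\<in>K - {pv}. indicator (A p) (0 :: real))"
      using K by (auto simp: indicator_def prod_zero_iff)
    also have "(\<Prod>p\<in>K - {pv}. indicator (A p) (0 :: real)) = (\<Prod>p\<in>K - {pv}. emeasure (D' p) (A p))"
      using A' D'(2) by (intro prod.cong) auto
    also have "emeasure (D' pv) (A pv) * \<dots> = (\<Prod>p\<in>K. emeasure (D' p) (A p))"
      using K by (simp add: prod.remove)
    finally show "emeasure (distr (PiM K D) (PiM K D') g) (Pi\<^sub>E K A) = (\<Prod>p\<in>K. emeasure (D' p) (A p))" .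
  qed simp
qed

section \<open>Traces of powers of the Gram matrix\<close>

definition entries_mat :: "nat \<Rightarrow> nat \<Rightarrow> (nat \<times> nat \<Rightarrow> real) \<Rightarrow> real mat" where
  "entries_mat m n w = mat m n (\<lambda>(i, j). w (Suc i, Suc j))"

text \<open>The shift of the exponent agrees with that of \<open>nth_of_power_sums\<close>. Exponent
  0 would record the size of the matrix and break the symmetry under transposition.\<close>

definition gram_traces :: "nat \<Rightarrow> nat \<Rightarrow> (nat \<times> nat \<Rightarrow> real) \<Rightarrow> nat \<Rightarrow> real" where
  "gram_traces m n w r = mat_trace ((entries_mat m n w * (entries_mat m n w)\<^sup>T) ^\<^sub>m Suc r)"

text \<open>The Gram matrix consists of the inner products of rows, so every orthogonal
  transformation of the columns is covered.\<close>

lemma gram_traces_cong: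
  assumes "\<And>i i'. i \<in> {1..m} \<Longrightarrow> i' \<in> {1..m} \<Longrightarrow>
    (\<Sum>l\<in>{1..n}. w (i, l) * w (i', l)) = (\<Sum>l\<in>{1..n}. w' (i, l) * w' (i', l))"
  shows "gram_traces m n w = gram_traces m n w'"
proof -
  have e: "entries_mat m n w * (entries_mat m n w)\<^sup>T = mat m m (\<lambda>(i, i'). \<Sum>l\<in>{1..n}. w (Suc i, l) * w (Suc i', l))" for w
  proof (rule eq_matI)
    fix i j assume "i < dim_row (mat m m (\<lambda>(i, i'). \<Sum>l\<in>{1..n}. w (Suc i, l) * w (Suc i', l)))"
      "j < dim_col (mat m m (\<lambda>(i, i'). \<Sum>l\<in>{1..n}. w (Suc i, l) * w (Suc i', l)))"
    then have ij: "i < m" "j < m" by auto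
    have "(\<Sum>l\<in>{1..n}. w (Suc i, l) * w (Suc j, l)) = (\<Sum>l<n. w (Suc i, Suc l) * w (Suc j, Suc l))"
      by (rule sum.reindex_bij_witness[of _ Suc "\<lambda>l. l - 1"]) auto
    then show "(entries_mat m n w * (entries_mat m n w)\<^sup>T) $$ (i, j) = mat m m (\<lambda>(i, i'). \<Sum>l\<in>{1..n}. w (Suc i, l) * w (Suc i', l)) $$ (i, j)"
      using ij by (simp add: entries_mat_def scalar_prod_def atLeast0LessThan)
  qed (auto simp: entries_mat_def)
  have "entries_mat m n w * (entries_mat m n w)\<^sup>T = entries_mat m n w' * (entries_mat m n w')\<^sup>T"
    unfolding e using assms by (intro cong_mat) auto
  then show ?thesis by (simp add: gram_traces_def fun_eq_iff)
qed

lemma gram_traces_swap: "gram_traces m n w = gram_traces n m (\<lambda>(l, i). w (i, l))"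
proof -
  have c: "entries_mat m n w \<in> carrier_mat m n" "(entries_mat m n w)\<^sup>T \<in> carrier_mat n m"
    by (auto simp: entries_mat_def)
  have t: "entries_mat n m (\<lambda>(l, i). w (i, l)) = (entries_mat m n w)\<^sup>T"
    by (intro eq_matI) (auto simp: entries_mat_def)
  show ?thesis
    by (rule ext, unfold gram_traces_def t) (simp only: mat_trace_pow_comm[OF c] transpose_transpose)
qed

lemma measurable_gram_traces:
  "gram_traces m n \<in> PiM ({1..m} \<times> {1..n}) (\<lambda>_. borel) \<rightarrow>\<^sub>M PiM UNIV (\<lambda>_. borel)"
proof (rule measurable_PiM_single')
  let ?M = "PiM ({1..m} \<times> {1..n}) (\<lambda>_. borel :: real measure)"
  define W where "W w = entries_mat m n w * (entries_mat m n w)\<^sup>T" for w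
  have W: "W w \<in> carrier_mat m m" for w by (auto simp: W_def entries_mat_def)
  have Wm: "(\<lambda>w. W w $$ (i, j)) \<in> borel_measurable ?M" if "i < m" "j < m" for i j
  proof -
    have "(\<lambda>w. W w $$ (i, j)) = (\<lambda>w. \<Sum>l<n. w (Suc i, Suc l) * w (Suc j, Suc l))"
      using that by (simp add: W_def entries_mat_def scalar_prod_def atLeast0LessThan)
    also have "\<dots> \<in> borel_measurable ?M"
      using that by (intro borel_measurable_sum borel_measurable_times measurable_component_singleton) auto
    finally show ?thesis .
  qed
  have P: "(\<lambda>w. (W w ^\<^sub>m r) $$ (i, j)) \<in> borel_measurable ?M" if "i < m" "j < m" for i j r
    using that
  proof (induction r arbitrary: i j)
    case 0
    have "dim_row (W w) = m" for w using W by auto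
    then show ?case using 0 by simp
  next
    case (Suc r)
    have "(\<lambda>w. (W w ^\<^sub>m Suc r) $$ (i, j)) = (\<lambda>w. \<Sum>l<m. (W w ^\<^sub>m r) $$ (i, l) * W w $$ (l, j))"
    proof
      fix w
      show "(W w ^\<^sub>m Suc r) $$ (i, j) = (\<Sum>l<m. (W w ^\<^sub>m r) $$ (i, l) * W w $$ (l, j))"
        using W[of w] pow_carrier_mat[OF W[of w], of r] Suc.prems
        by (simp add: scalar_prod_def atLeast0LessThan)
    qed
    also have "\<dots> \<in> borel_measurable ?M"
      using Suc Wm by (intro borel_measurable_sum borel_measurable_times) auto
    finally show ?case .
  qed
  fix r
  have "(\<lambda>w. gram_traces m n w r) = (\<lambda>w. \<Sum>i<m. (W w ^\<^sub>m Suc r) $$ (i, i))"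
    using carrier_matD(1)[OF pow_carrier_mat[OF W]] by (simp add: gram_traces_def mat_trace_def W_def[symmetric] del: pow_mat.simps)
  also have "\<dots> \<in> borel_measurable ?M" by (intro borel_measurable_sum P) auto
  finally show "(\<lambda>w. gram_traces m n w r) \<in> borel_measurable ?M" .
qed auto

text \<open>The pivot coordinates are the entries of row \<open>ip\<close> in the columns
  \<open>C\<close>. An orthogonal transformation of these columns, chosen from the pivot entries,
  concentrates them in \<open>cp\<close> and acts on all other rows as well. There it preserves the
  conditional law, because the entries of each row in \<open>C\<close> are normal with equal
  variance. Variance 0 admits rows that already vanish on \<open>C\<close>.\<close>

lemma distr_gram_traces_row:
  assumes D: "prob_laws D" "prob_laws D'" and ip: "ip \<in> {1..m}" and C: "C \<subseteq> {1..n}" "cp \<in> C" and \<tau>: "\<tau> \<ge> 0"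
    and n: "\<And>l. l \<in> C \<Longrightarrow> D (ip, l) = normal_law \<tau>"
    and n': "\<And>i l. i \<in> {1..m} \<Longrightarrow> i \<noteq> ip \<Longrightarrow> l \<in> C \<Longrightarrow> D (i, l) = normal_law (s i)" "\<And>i. s i \<ge> 0"
    and D': "D' (ip, cp) = scaled_chi_law \<tau> (card C)" "\<And>l. l \<in> C \<Longrightarrow> l \<noteq> cp \<Longrightarrow> D' (ip, l) = return borel 0"
    and same: "\<And>i l. i \<in> {1..m} \<Longrightarrow> l \<in> {1..n} \<Longrightarrow> i \<noteq> ip \<or> l \<notin> C \<Longrightarrow> D (i, l) = D' (i, l)"
  defines "I \<equiv> {1..m} \<times> {1..n}"
  shows "distr (PiM I D) (PiM UNIV (\<lambda>_. borel)) (gram_traces m n) = distr (PiM I D') (PiM UNIV (\<lambda>_. borel)) (gram_traces m n)"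
proof -
  define K where "K = {ip} \<times> C"
  define J where "J = I - K"
  have finC: "finite C" using C(1) finite_subset by auto
  have K: "finite K" "K \<subseteq> I" "(ip, cp) \<in> K" "card K = card C"
    using finC C ip by (auto simp: K_def I_def card_cartesian_product_singleton)
  define g where "g = (\<lambda>y. \<lambda>p\<in>K. if p = (ip, cp) then sqrt (\<Sum>q\<in>K. (y q)\<^sup>2) else 0 :: real)"
  have nK: "\<And>p. p \<in> K \<Longrightarrow> D p = normal_law \<tau>" using n by (auto simp: K_def)
  have g: "g \<in> PiM K D \<rightarrow>\<^sub>M PiM K D'" "distr (PiM K D) (PiM K D') g = PiM K D'"
    unfolding g_def using D' K
    by (intro distr_concentrate_norm[OF D K(1,3) \<tau> nK]; auto simp: K_def)+
  show ?thesis
  proof (rule distr_PiM_pivot[OF D _ K(2) _ g])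
    show "finite I" by (simp add: I_def)
    show "D p = D' p" if "p \<in> I - K" for p
      using that same[of "fst p" "snd p"] by (auto simp: I_def K_def mem_Times_iff prod_eq_iff)
    show "gram_traces m n \<in> PiM I (\<lambda>_. borel) \<rightarrow>\<^sub>M PiM UNIV (\<lambda>_. borel)"
      unfolding I_def by (rule measurable_gram_traces)
    fix y
    have "insert cp (C - {cp}) = C" using C by auto
    then obtain T where T: "T \<in> line_moves C"
      "T (\<lambda>l. y (ip, l)) cp = sqrt (\<Sum>l\<in>C. (y (ip, l))\<^sup>2)" "\<forall>l\<in>C - {cp}. T (\<lambda>l. y (ip, l)) l = 0"
      using line_moves_reduce[of "C - {cp}" cp "\<lambda>l. y (ip, l)"] finC by auto
    let ?R = "{1..m} - {ip}"
    have "measure_preserving_map (PiM J D) (on_rows ?R T)"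
      using n' C(1) by (intro measure_preserving_on_rows[OF D(1) _ _ _ _ _ T(1), of _ _ s]) (auto simp: J_def I_def K_def)
    moreover have "gram_traces m n (merge K J (y, x)) = gram_traces m n (merge K J (g y, on_rows ?R T x))"
      if x: "x \<in> extensional J" for x
    proof (rule gram_traces_cong)
      let ?w = "merge K J (y, x)" and ?w' = "merge K J (g y, on_rows ?R T x)"
      \<comment> \<open>The new matrix is the old one with \<open>T\<close> applied to every row: on
        row \<open>ip\<close> this is the effect of \<open>g\<close>, on the other rows that of
        \<open>on_rows\<close>. Equality of the Gram matrices is then orthogonality of
        \<open>T\<close>.\<close>
      have e: "?w' (i, l) = T (\<lambda>l. ?w (i, l)) l" if il: "i \<in> {1..m}" "l \<in> {1..n}" for i l
      proof (cases "l \<in> C")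
        case l: True
        show ?thesis
        proof (cases "i = ip")
          case True
          have "T (\<lambda>l. ?w (ip, l)) l = T (\<lambda>l. y (ip, l)) l"
            using l by (intro line_moves_local[OF T(1)]) (auto simp: merge_def K_def)
          moreover have "(\<Sum>q\<in>K. (y q)\<^sup>2) = (\<Sum>l\<in>C. (y (ip, l))\<^sup>2)"
            unfolding K_def by (rule sum.reindex_bij_witness[of _ "Pair ip" snd]) auto
          ultimately show ?thesis
            using l True T by (auto simp: merge_def K_def g_def)
        next
          case False
          have "T (\<lambda>l. ?w (i, l)) l = T (\<lambda>l. x (i, l)) l"
            using l False il C(1) by (intro line_moves_local[OF T(1)]) (auto simp: merge_def K_def J_def I_def)
          then show ?thesis using l False il by (auto simp: merge_def K_def J_def I_def on_rows_def)
        qed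
      next
        case False
        then have "T (\<lambda>l. ?w (i, l)) l = x (i, l)" "T (\<lambda>l. x (i, l)) l = x (i, l)"
          using il by (auto simp: line_moves_outside[OF T(1)] merge_def K_def J_def I_def)
        then show ?thesis using False il by (auto simp: merge_def K_def J_def I_def on_rows_def)
      qed
      fix i i' assume i: "i \<in> {1..m}" "i' \<in> {1..m}"
      have "(\<Sum>l\<in>{1..n}. ?w' (i, l) * ?w' (i', l)) = (\<Sum>l\<in>{1..n}. T (\<lambda>l. ?w (i, l)) l * T (\<lambda>l. ?w (i', l)) l)"
        using i by (intro sum.cong refl arg_cong2[of _ _ _ _ "(*)"] e) auto
      also have "\<dots> = (\<Sum>l\<in>{1..n}. ?w (i, l) * ?w (i', l))"
        using C(1) by (intro line_moves_inner[OF T(1)]) auto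
      finally show "(\<Sum>l\<in>{1..n}. ?w (i, l) * ?w (i', l)) = (\<Sum>l\<in>{1..n}. ?w' (i, l) * ?w' (i', l))" ..
    qed
    ultimately show "\<exists>T. measure_preserving_map (PiM (I - K) D) T \<and>
      (\<forall>x. x \<in> extensional (I - K) \<longrightarrow> gram_traces m n (merge K (I - K) (y, x)) = gram_traces m n (merge K (I - K) (g y, T x)))"
      unfolding J_def[symmetric] by blast
  qed
qed

lemma distr_gram_traces_swap:
  assumes D: "prob_laws D"
  shows "distr (PiM ({1..m} \<times> {1..n}) D) (PiM UNIV (\<lambda>_. borel)) (gram_traces m n) =
    distr (PiM ({1..n} \<times> {1..m}) (\<lambda>(l, i). D (i, l))) (PiM UNIV (\<lambda>_. borel)) (gram_traces n m)"
proof -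
  let ?I = "{1..m} \<times> {1..n}" and ?J = "{1..n} \<times> {1..m}"
  let ?sw = "\<lambda>p :: nat \<times> nat. (snd p, fst p)"
  let ?t = "\<lambda>w :: nat \<times> nat \<Rightarrow> real. \<lambda>p\<in>?J. w (?sw p)"
  have D': "prob_laws (\<lambda>p. D (?sw p))" using D by (auto simp: prob_laws_def)
  have e: "(\<lambda>(l, i). D (i, l)) = (\<lambda>p. D (?sw p))" by auto
  have r: "distr (PiM ?I D) (PiM ?J (\<lambda>p. D (?sw p))) ?t = PiM ?J (\<lambda>p. D (?sw p))"
    by (rule distr_PiM_reindex) (auto intro: prob_lawsD[OF D] simp: inj_on_def)
  have t: "?t \<in> PiM ?I D \<rightarrow>\<^sub>M PiM ?J (\<lambda>p. D (?sw p))"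
    by (intro measurable_restrict measurable_component_singleton) auto
  have "gram_traces m n w = gram_traces n m (?t w)" for w
    unfolding gram_traces_swap[of m n] by (rule gram_traces_cong) (auto intro!: sum.cong)
  then have "gram_traces m n = gram_traces n m \<circ> ?t" by (auto simp: o_def)
  then show ?thesis
    unfolding e
    by (subst r[symmetric], subst distr_distr[OF _ t]) (simp_all only: PiM_eq_borel[OF D'] measurable_gram_traces)
qed

text \<open>Transposition exchanges rows and columns without changing the traces, so the row version
  applies. The equal variances are now required along each column.\<close>

lemma distr_gram_traces_col:
  assumes D: "prob_laws D" "prob_laws D'" and lp: "lp \<in> {1..n}" and C: "C \<subseteq> {1..m}" "cp \<in> C" and \<tau>: "\<tau> \<ge> 0"
    and n: "\<And>i. i \<in> C \<Longrightarrow> D (i, lp) = normal_law \<tau>"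
    and n': "\<And>i l. i \<in> C \<Longrightarrow> l \<in> {1..n} \<Longrightarrow> l \<noteq> lp \<Longrightarrow> D (i, l) = normal_law (s l)" "\<And>l. s l \<ge> 0"
    and D': "D' (cp, lp) = scaled_chi_law \<tau> (card C)" "\<And>i. i \<in> C \<Longrightarrow> i \<noteq> cp \<Longrightarrow> D' (i, lp) = return borel 0"
    and same: "\<And>i l. i \<in> {1..m} \<Longrightarrow> l \<in> {1..n} \<Longrightarrow> l \<noteq> lp \<or> i \<notin> C \<Longrightarrow> D (i, l) = D' (i, l)"
  defines "I \<equiv> {1..m} \<times> {1..n}"
  shows "distr (PiM I D) (PiM UNIV (\<lambda>_. borel)) (gram_traces m n) = distr (PiM I D') (PiM UNIV (\<lambda>_. borel)) (gram_traces m n)"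
  unfolding I_def distr_gram_traces_swap[OF D(1)] distr_gram_traces_swap[OF D(2)]
  using assms by (intro distr_gram_traces_row[where ip = lp and C = C and cp = cp and \<tau> = \<tau> and s = s]) (auto simp: prob_laws_def)

subsection \<open>Band reduction\<close>

text \<open>Writing the lower edge of the band as \<open>i = j + k\<close> avoids truncated
  subtraction. On the index set the degrees of freedom are not truncated either:
  \<open>i = j\<close> gives i at most n, and \<open>i = j + k\<close> has i at most m.\<close>

definition band_law :: "nat \<Rightarrow> nat \<Rightarrow> nat \<Rightarrow> (nat \<Rightarrow> real) \<Rightarrow> nat \<times> nat \<Rightarrow> real measure" where
  "band_law m n k \<sigma> = (\<lambda>(i, j).
     if i = j then scaled_chi_law (\<sigma> i) (n - i + 1)
     else if i = j + k then scaled_chi_law (\<sigma> i) (m - i + 1)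
     else if j < i \<and> i < j + k then normal_law (\<sigma> i)
     else return borel 0)"

text \<open>The law of the matrix after reduction of the first \<open>a\<close> rows and the first \<open>b\<close> columns.\<close>

definition stage_law :: "nat \<Rightarrow> nat \<Rightarrow> nat \<Rightarrow> (nat \<Rightarrow> real) \<Rightarrow> nat \<Rightarrow> nat \<Rightarrow> nat \<times> nat \<Rightarrow> real measure" where
  "stage_law m n k \<sigma> a b = (\<lambda>(i, j).
     if i \<le> a \<or> j \<le> b then band_law m n k \<sigma> (i, j) else normal_law (\<sigma> i))"

lemma prob_laws_stage_law:
  assumes "\<And>i. \<sigma> i \<ge> 0"
  shows "prob_laws (stage_law m n k \<sigma> a b)"
  using assms
  by (auto simp: prob_laws_def stage_law_def band_law_def prob_space_scaled_chi_law
      prob_space_normal_law prob_space_return)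

lemma normal_law_zero: "normal_law 0 = return borel 0"
  by (simp add: normal_law_def)

text \<open>Row \<open>Suc j\<close> is concentrated in its diagonal entry. The earlier rows already
  vanish in the columns beyond j, which is expressed by standard deviation 0. The n - j entries
  involved give n - i + 1 degrees of freedom for i = \<open>Suc j\<close>. Past the last row or
  column the two laws agree on the index set.\<close>

lemma distr_gram_traces_stage_row:
  assumes nonneg: "\<And>i. \<sigma> i \<ge> 0"
  shows "distr (PiM ({1..m} \<times> {1..n}) (stage_law m n k \<sigma> j j)) (PiM UNIV (\<lambda>_. borel)) (gram_traces m n)
       = distr (PiM ({1..m} \<times> {1..n}) (stage_law m n k \<sigma> (Suc j) j)) (PiM UNIV (\<lambda>_. borel)) (gram_traces m n)"
proof (cases "Suc j \<le> m \<and> Suc j \<le> n")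
  case True
  show ?thesis
  proof (rule distr_gram_traces_row[OF prob_laws_stage_law[OF nonneg] prob_laws_stage_law[OF nonneg],
        where ip = "Suc j" and cp = "Suc j" and C = "{Suc j..n}" and \<tau> = "\<sigma> (Suc j)" and s = "\<lambda>i. if i \<le> j then 0 else \<sigma> i"])
  qed (use True nonneg in \<open>auto simp: stage_law_def band_law_def normal_law_zero Suc_diff_Suc Suc_diff_le\<close>)
next
  case False
  then have "PiM ({1..m} \<times> {1..n}) (stage_law m n k \<sigma> j j) = PiM ({1..m} \<times> {1..n}) (stage_law m n k \<sigma> (Suc j) j)"
    by (intro PiM_cong) (auto simp: stage_law_def)
  then show ?thesis by simp
qed

text \<open>This step mixes different rows, so it needs equal variances down a column. All rows
  involved have index greater than k, where the standard deviation is 1. The earlier columns are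
  already 0 in these rows, and the entries strictly between the diagonal and row
  \<open>Suc j + k\<close> stay normal.\<close>

lemma distr_gram_traces_stage_col:
  assumes nonneg: "\<And>i. \<sigma> i \<ge> 0" and one: "\<And>i. i \<in> {1..m} \<Longrightarrow> i > k \<Longrightarrow> \<sigma> i = 1" and "k \<ge> 1"
  shows "distr (PiM ({1..m} \<times> {1..n}) (stage_law m n k \<sigma> (Suc j) j)) (PiM UNIV (\<lambda>_. borel)) (gram_traces m n)
       = distr (PiM ({1..m} \<times> {1..n}) (stage_law m n k \<sigma> (Suc j) (Suc j))) (PiM UNIV (\<lambda>_. borel)) (gram_traces m n)"
proof (cases "Suc j + k \<le> m \<and> Suc j \<le> n")
  case True
  show ?thesis
  proof (rule distr_gram_traces_col[OF prob_laws_stage_law[OF nonneg] prob_laws_stage_law[OF nonneg],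
        where lp = "Suc j" and cp = "Suc j + k" and C = "{Suc j + k..m}" and \<tau> = 1 and s = "\<lambda>l. if l \<le> j then 0 else 1"])
  qed (use True one \<open>k \<ge> 1\<close> in \<open>auto simp: stage_law_def band_law_def normal_law_zero Suc_diff_Suc Suc_diff_le\<close>)
next
  case False
  then have "PiM ({1..m} \<times> {1..n}) (stage_law m n k \<sigma> (Suc j) j) = PiM ({1..m} \<times> {1..n}) (stage_law m n k \<sigma> (Suc j) (Suc j))"
    using \<open>k \<ge> 1\<close> by (intro PiM_cong) (auto simp: stage_law_def band_law_def)
  then show ?thesis by simp
qed

lemma distr_gram_traces_band:
  assumes nonneg: "\<And>i. \<sigma> i \<ge> 0" and one: "\<And>i. i \<in> {1..m} \<Longrightarrow> i > k \<Longrightarrow> \<sigma> i = 1" and k: "k \<ge> 1"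
  shows "distr (PiM ({1..m} \<times> {1..n}) (\<lambda>(i, j). normal_law (\<sigma> i))) (PiM UNIV (\<lambda>_. borel)) (gram_traces m n)
       = distr (PiM ({1..m} \<times> {1..n}) (band_law m n k \<sigma>)) (PiM UNIV (\<lambda>_. borel)) (gram_traces m n)"
proof -
  have "distr (PiM ({1..m} \<times> {1..n}) (stage_law m n k \<sigma> 0 0)) (PiM UNIV (\<lambda>_. borel)) (gram_traces m n)
       = distr (PiM ({1..m} \<times> {1..n}) (stage_law m n k \<sigma> j j)) (PiM UNIV (\<lambda>_. borel)) (gram_traces m n)" for j
   
  proof (induction j)
    case (Suc j)
    then show ?case
      by (rule trans[OF _ trans[OF distr_gram_traces_stage_row[OF nonneg] distr_gram_traces_stage_col[OF nonneg one k]]])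
  qed simp
  \<comment> \<open>After m rounds every row of the index set counts as reduced, also when n <
    m.\<close>
  note this[of m]
  moreover have "PiM ({1..m} \<times> {1..n}) (stage_law m n k \<sigma> 0 0) = PiM ({1..m} \<times> {1..n}) (\<lambda>(i, j). normal_law (\<sigma> i))"
    by (intro PiM_cong) (auto simp: stage_law_def)
  moreover have "PiM ({1..m} \<times> {1..n}) (stage_law m n k \<sigma> m m) = PiM ({1..m} \<times> {1..n}) (band_law m n k \<sigma>)"
    by (intro PiM_cong) (auto simp: stage_law_def)
  ultimately show ?thesis by simp
qed

section \<open>From traces back to the vector of eigenvalues\<close>

definition eigenvalues_of_traces :: "nat \<Rightarrow> (nat \<Rightarrow> real) \<Rightarrow> nat \<Rightarrow> real" where
  "eigenvalues_of_traces m t = (\<lambda>i\<in>{1..m}. nth_of_power_sums (i - 1) t)"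

lemma measurable_eigenvalues_of_traces:
  "eigenvalues_of_traces m \<in> PiM UNIV (\<lambda>_. borel) \<rightarrow>\<^sub>M PiM {1..m} (\<lambda>_. borel)"
  unfolding eigenvalues_of_traces_def by measurable

lemma eigenvalue_vector_gram:
  assumes A: "A \<in> carrier_mat m n" and w: "\<And>i j. i \<in> {1..m} \<Longrightarrow> j \<in> {1..n} \<Longrightarrow> w (i, j) = entry A i j"
  shows "eigenvalue_vector m (A * A\<^sup>T) = eigenvalues_of_traces m (gram_traces m n w)"
proof -
  have e: "entries_mat m n w = A"
    using A w by (intro eq_matI) (auto simp: entries_mat_def entry_def)
  show ?thesis
    unfolding eigenvalue_vector_def eigenvalues_of_traces_def
  proof (rule restrict_ext)
    fix i assume i: "i \<in> {1..m}"
    show "eigenvalues_desc (A * A\<^sup>T) ! (i - 1) = nth_of_power_sums (i - 1) (gram_traces m n w)"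
      by (rule nth_of_power_sums[symmetric])
         (use i eigenvalues_desc_gram[OF A] in \<open>auto simp: gram_traces_def e eigenvalues_desc_antimono simp del: pow_mat.simps power_Suc\<close>)
  qed
qed

text \<open>Independence makes the joint law of the entries the product of the marginals. The law of
  the eigenvalues is then the image of this product under the traces followed by the reconstruction
  map, a form that serves both random matrices.\<close>

lemma distr_eigenvalue_vector:
  fixes M :: "'a measure" and G :: "'a \<Rightarrow> real mat"
  assumes mn: "m \<ge> 1" "n \<ge> 1" and M: "prob_space M"
    and G: "\<And>x. x \<in> space M \<Longrightarrow> G x \<in> carrier_mat m n"
    and ind: "prob_space.indep_vars M (\<lambda>_. borel) (\<lambda>(i, j) x. entry (G x) i j) ({1..m} \<times> {1..n})"
    and D: "prob_laws D" "\<And>i j. i \<in> {1..m} \<Longrightarrow> j \<in> {1..n} \<Longrightarrow> distr M borel (\<lambda>x. entry (G x) i j) = D (i, j)"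
  shows "(\<lambda>x. eigenvalue_vector m (G x * (G x)\<^sup>T)) \<in> M \<rightarrow>\<^sub>M PiM {1..m} (\<lambda>_. borel)"
    and "distr M (PiM {1..m} (\<lambda>_. borel)) (\<lambda>x. eigenvalue_vector m (G x * (G x)\<^sup>T)) =
      distr (distr (PiM ({1..m} \<times> {1..n}) D) (PiM UNIV (\<lambda>_. borel)) (gram_traces m n))
        (PiM {1..m} (\<lambda>_. borel)) (eigenvalues_of_traces m)"
proof -
  interpret prob_space M by (rule M)
  let ?I = "{1..m} \<times> {1..n}"
  let ?B = "PiM ?I (\<lambda>_. borel :: real measure)" and ?S = "PiM UNIV (\<lambda>_. borel :: real measure)"
    and ?V = "PiM {1..m} (\<lambda>_. borel :: real measure)"
  define X where "X p x = entry (G x) (fst p) (snd p)" for p x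
  have X: "(\<lambda>(i, j) x. entry (G x) i j) = X" by (auto simp: X_def fun_eq_iff)
  have rv: "X p \<in> borel_measurable M" if "p \<in> ?I" for p
    using ind that unfolding X indep_vars_def by auto
  define E where "E x = (\<lambda>p\<in>?I. X p x)" for x
  have E: "E \<in> M \<rightarrow>\<^sub>M ?B" unfolding E_def by (intro measurable_restrict rv)
  have "?I \<noteq> {}" using mn by auto
  from indep_vars_iff_distr_eq_PiM'[OF this rv, THEN iffD1, OF _ ind[unfolded X]]
  have "distr M ?B E = PiM ?I (\<lambda>p. distr M borel (X p))" by (simp add: E_def[abs_def])
  also have "\<dots> = PiM ?I D"
    using D(2) by (intro PiM_cong) (auto simp: X_def[abs_def])
  finally have law: "distr M ?B E = PiM ?I D" .
  note g = measurable_gram_traces[of m n] and v = measurable_eigenvalues_of_traces[of m]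
  have eq: "eigenvalue_vector m (G x * (G x)\<^sup>T) = (eigenvalues_of_traces m \<circ> (gram_traces m n \<circ> E)) x" if "x \<in> space M" for x
    using eigenvalue_vector_gram[OF G[OF that], of "E x"] by (simp add: E_def X_def)
  show "(\<lambda>x. eigenvalue_vector m (G x * (G x)\<^sup>T)) \<in> M \<rightarrow>\<^sub>M ?V"
    using measurable_comp[OF measurable_comp[OF E g] v] by (simp only: measurable_cong[OF eq])
  have "distr M ?V (\<lambda>x. eigenvalue_vector m (G x * (G x)\<^sup>T)) = distr M ?V (eigenvalues_of_traces m \<circ> (gram_traces m n \<circ> E))"
    by (intro distr_cong eq refl)
  also have "\<dots> = distr (distr (distr M ?B E) ?S (gram_traces m n)) ?V (eigenvalues_of_traces m)"
    by (simp only: distr_distr[OF g E] distr_distr[OF v measurable_comp[OF E g]])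
  finally show "distr M ?V (\<lambda>x. eigenvalue_vector m (G x * (G x)\<^sup>T)) =
      distr (distr (PiM ?I D) ?S (gram_traces m n)) ?V (eigenvalues_of_traces m)"
    by (simp only: law)
qed

theorem theorem0p1:
  fixes m n k :: nat and \<sigma> :: "nat \<Rightarrow> real"
    and M :: "'a measure" and N :: "'b measure"
    and G :: "'a \<Rightarrow> real mat" and H :: "'b \<Rightarrow> real mat"
  assumes "m \<ge> 1" and "n \<ge> 1" and "k \<ge> 1" and "k \<le> m"
    and "\<And>i. i \<in> {1..m} \<Longrightarrow> \<sigma> i \<ge> 0"
    and "\<And>i. i \<in> {1..m} \<Longrightarrow> i > k \<Longrightarrow> \<sigma> i = 1"
    and "prob_space M"
    and "\<And>x. x \<in> space M \<Longrightarrow> G x \<in> carrier_mat m n"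
    and "prob_space.indep_vars M (\<lambda>_. borel) (\<lambda>(i, j) x. entry (G x) i j) ({1..m} \<times> {1..n})"
    and "\<And>i j. i \<in> {1..m} \<Longrightarrow> j \<in> {1..n} \<Longrightarrow>
           distr M borel (\<lambda>x. entry (G x) i j) = normal_law (\<sigma> i)"
    and "prob_space N"
    and "\<And>y. y \<in> space N \<Longrightarrow> H y \<in> carrier_mat m n"
    and "prob_space.indep_vars N (\<lambda>_. borel) (\<lambda>(i, j) y. entry (H y) i j) ({1..m} \<times> {1..n})"
    and "\<And>i. i \<in> {1..m} \<Longrightarrow> i \<in> {1..n} \<Longrightarrow>
           distr N borel (\<lambda>y. entry (H y) i i) = scaled_chi_law (\<sigma> i) (n - i + 1)"
    and "\<And>i. i \<in> {1..m} \<Longrightarrow> i > k \<Longrightarrow> i - k \<in> {1..n} \<Longrightarrow>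
           distr N borel (\<lambda>y. entry (H y) i (i - k)) = scaled_chi_law (\<sigma> i) (m - i + 1)"
    and "\<And>i j. i \<in> {1..m} \<Longrightarrow> j \<in> {1..n} \<Longrightarrow> i < j + k \<Longrightarrow> j < i \<Longrightarrow>
           distr N borel (\<lambda>y. entry (H y) i j) = normal_law (\<sigma> i)"
    and "\<And>i j. i \<in> {1..m} \<Longrightarrow> j \<in> {1..n} \<Longrightarrow> j > i \<or> j + k < i \<Longrightarrow>
           AE y in N. entry (H y) i j = 0"
  shows "(\<lambda>x. eigenvalue_vector m (G x * transpose_mat (G x))) \<in> M \<rightarrow>\<^sub>M PiM {1..m} (\<lambda>_. borel) \<and>
    (\<lambda>y. eigenvalue_vector m (H y * transpose_mat (H y))) \<in> N \<rightarrow>\<^sub>M PiM {1..m} (\<lambda>_. borel) \<and>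
    distr M (PiM {1..m} (\<lambda>_. borel)) (\<lambda>x. eigenvalue_vector m (G x * transpose_mat (G x))) =
    distr N (PiM {1..m} (\<lambda>_. borel)) (\<lambda>y. eigenvalue_vector m (H y * transpose_mat (H y)))"
proof -
  \<comment> \<open>\<open>\<sigma>\<close> may be negative outside \<open>{1..m}\<close>, where \<open>normal_law\<close> need not be a probability measure.\<close>
  define \<sigma>' where "\<sigma>' i = (if i \<in> {1..m} then \<sigma> i else 0)" for i
  have nonneg: "\<sigma>' i \<ge> 0" for i using assms(5) by (simp add: \<sigma>'_def)
  have one: "\<sigma>' i = 1" if "i \<in> {1..m}" "i > k" for i using assms(6) that by (simp add: \<sigma>'_def)
  have DG: "prob_laws (\<lambda>(i :: nat, j :: nat). normal_law (\<sigma>' i))"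
    using nonneg by (auto simp: prob_laws_def prob_space_normal_law)
  have DH: "prob_laws (band_law m n k \<sigma>')"
    using nonneg by (auto simp: prob_laws_def band_law_def prob_space_scaled_chi_law prob_space_normal_law prob_space_return)
  have lawG: "distr M borel (\<lambda>x. entry (G x) i j) = (\<lambda>(i, j). normal_law (\<sigma>' i)) (i, j)"
    if "i \<in> {1..m}" "j \<in> {1..n}" for i j
    using assms(10) that by (simp add: \<sigma>'_def)
  interpret N: prob_space N by (rule assms)
  have lawH: "distr N borel (\<lambda>y. entry (H y) i j) = band_law m n k \<sigma>' (i, j)"
    if ij: "i \<in> {1..m}" "j \<in> {1..n}" for i j
  proof -
    have rv: "(\<lambda>y. entry (H y) i j) \<in> borel_measurable N"
      using assms(13) ij unfolding N.indep_vars_def by auto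
    consider "i = j" | "i = j + k" | "j < i" "i < j + k" | "j > i \<or> j + k < i" by linarith
    then show ?thesis
    proof cases
      case 1
      then show ?thesis using assms(14)[of i] ij by (simp add: band_law_def \<sigma>'_def)
    next
      case 2
      then show ?thesis using assms(15)[of i] assms(3) ij by (simp add: band_law_def \<sigma>'_def)
    next
      case 3
      then show ?thesis using assms(16)[of i j] ij by (simp add: band_law_def \<sigma>'_def)
    next
      case 4
      then have "AE y in N. entry (H y) i j = 0" using assms(17) ij by blast
      then have "distr N borel (\<lambda>y. entry (H y) i j) = distr N borel (\<lambda>_. 0)"
        using rv by (intro distr_cong_AE) auto
      also have "\<dots> = return borel 0" by (simp add: N.distr_const)
      finally show ?thesis using 4 assms(3) by (auto simp: band_law_def)
    qed
  qed
  note lG = distr_eigenvalue_vector[OF assms(1,2,7,8,9) DG lawG]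
  note lH = distr_eigenvalue_vector[OF assms(1,2,11,12,13) DH lawH]
  \<comment> \<open>Both eigenvalue laws are images of trace laws under the same measurable map, so
    it suffices that the trace laws agree.\<close>
  have "distr (PiM ({1..m} \<times> {1..n}) (\<lambda>(i, j). normal_law (\<sigma>' i))) (PiM UNIV (\<lambda>_. borel)) (gram_traces m n)
      = distr (PiM ({1..m} \<times> {1..n}) (band_law m n k \<sigma>')) (PiM UNIV (\<lambda>_. borel)) (gram_traces m n)"
    by (rule distr_gram_traces_band[OF nonneg one assms(3)])
  then show ?thesis using lG lH by simp
qed

end
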